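(* Let $\alpha$ be a real number, and let $$P_\alpha(x,y)=(x+1)(y+1)(x+y)-\alpha xy,$$ $$S_\alpha(x,y)=y^2+(x^4+\alpha x^3+2\alpha x^2+\alpha x+1)\,y+x^4 .$$ Then $$\mathrm{m}(S_\alpha)=\begin{cases}2\,\mathrm{m}(P_\alpha) & \text{if } 0\le \alpha\le 4,\\ \mathrm{m}(P_\alpha) & \text{if } \alpha\le -1,\end{cases}$$ where $\mathrm{m}$ denotes the (logarithmic) Mahler measure.
   Context: The (logarithmic) Mahler measure of a non-zero rational function $P\in\mathbb{C}(x_1,\dots,x_n)$ is $$\mathrm{m}(P):=\frac{1}{(2\pi i)^n}\int_{\mathbb{T}^n}\log|P(x_1,\dots,x_n)|\,\frac{dx_1}{x_1}\cdots\frac{dx_n}{x_n},$$ where $\mathbb{T}^n=\{(x_1,\dots,x_n)\in\mathbb{C}^n : |x_1|=\cdots=|x_n|=1\}$. Here it is applied to polynomials in the $n=2$ variables $x,y$. *)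

theory Defs
  imports "HOL-Analysis.Analysis"
begin

text \<open>
  Rational functions in two variables enter through their values on the torus. The torus
  is parametrised by \<open>x = e\<^sup>i\<^sup>s\<close>, \<open>y = e\<^sup>i\<^sup>t\<close> with \<open>(s, t) \<in> [0, 2\<pi>]\<^sup>2\<close>, so that \<open>dx/x = i ds\<close> and
  \<open>dy/y = i dt\<close>; the factor \<open>i\<^sup>2\<close> cancels against \<open>(2\<pi>i)\<^sup>2\<close>. The convention \<open>ln 0 = 0\<close> only
  matters on the zero set of the function on the torus, a null set when the function is
  rational and non-zero.
\<close>

definition mahler_measure :: "(complex \<Rightarrow> complex \<Rightarrow> complex) \<Rightarrow> real" where
  "mahler_measure F =
     1 / (2 * pi)\<^sup>2 *
     (LINT (s, t) : {0..2 * pi} \<times> {0..2 * pi} | lborel. ln (cmod (F (cis s) (cis t))))"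

definition P_poly :: "real \<Rightarrow> complex \<Rightarrow> complex \<Rightarrow> complex" where
  "P_poly \<alpha> x y = (x + 1) * (y + 1) * (x + y) - of_real \<alpha> * x * y"

definition S_poly :: "real \<Rightarrow> complex \<Rightarrow> complex \<Rightarrow> complex" where
  "S_poly \<alpha> x y =
     y ^ 2 + (x ^ 4 + of_real \<alpha> * x ^ 3 + 2 * of_real \<alpha> * x ^ 2 + of_real \<alpha> * x + 1) * y + x ^ 4"

end

theory Submission
  imports Defs "HOL-Complex_Analysis.Complex_Analysis" "HOL-Real_Asymp.Real_Asymp"
begin

text \<open>
  On the torus both polynomials are real up to a unimodular factor and quadratic in \<open>y\<close> with
  reciprocal roots, so Jensen's formula in \<open>y\<close> leaves the mean over \<open>x = e\<^sup>i\<^sup>s\<close> of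
  \<open>arcosh (max 1 \<bar>h\<bar>)\<close>, where, with \<open>q = 1 + cos s\<close>, \<open>h = 2(q - 1)\<^sup>2 - 1 + \<alpha>q\<close> for \<open>S\<^sub>\<alpha>\<close> and
  \<open>h = (2q - \<alpha>)/(2 sqrt (2q))\<close> for \<open>P\<^sub>\<alpha>\<close>. Both are affine in \<open>\<alpha>\<close>, and the derivatives in \<open>\<alpha>\<close> of the
  two means are periods of elliptic curves. A map of degree two in \<open>q\<close> (a 2-isogeny) carries one
  integrand to the other: for \<open>\<alpha> < -1\<close> it is injective on the interval of integration, while for
  \<open>0 < \<alpha> < 4\<close> it covers the target interval twice, whence the factor 2. Since all integrands are
  nonnegative, Tonelli's theorem replaces differentiation under the integral sign. It remains to
  compare the measures at one point: both vanish at \<open>\<alpha> = 0\<close>, and both are \<open>ln \<bar>\<alpha>\<bar> + o(1)\<close> as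
  \<open>\<alpha>\<close> tends to \<open>-\<infinity>\<close>.
\<close>

subsection \<open>Jensen's formula on the unit circle\<close>

text \<open>The ranges of \<alpha> come from the fibres of the map. With
  \<open>M = a + 3 - 2 * q\<close> and \<open>a = - \<alpha>\<close>, the equation
  \<open>p = quad_map a q\<close> is a quadratic in \<open>M\<close> whose roots have product
  \<open>1 - a\<close> and whose discriminant is \<open>(a + 2 * p)\<^sup>2 - 8 * p\<close>, the
  quadratic factor under the square root in the period of the cubic family. For \<open>a > 1\<close>
  the product is negative, so exactly one root is positive and the map is injective where
  \<open>M > 0\<close>. For \<open>a < 0\<close> the product is 1 + \<alpha>, and the involution
  \<open>M \<mapsto> (1 + \<alpha>) / M\<close> folds the interval at
  \<open>M = - sqrt (1 + \<alpha>)\<close>; the interval starts at 2 - \<alpha>/2, which reaches 0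
  at \<alpha> = 4. For \<open>0 < a < 1\<close> the geometry is different: the interval of the
  quartic family ends at the two roots of \<open>N\<close>, and the integrand of the cubic family
  lives on two intervals. The negative case does not cross this range; its constant is fixed at
  minus infinity instead of at 0.\<close>

abbreviation circ :: "real measure" where
  "circ \<equiv> restrict_space lborel {0..2 * pi}"

lemma circ_continuous:
  fixes f :: "real \<Rightarrow> real"
  assumes "continuous_on {0..2 * pi} f"
  shows "integrable circ f" and "integral\<^sup>L circ f = integral {0..2 * pi} f"
proof -
  have "set_integrable lborel {0..2 * pi} f"
    by (rule borel_integrable_atLeastAtMost'[OF assms])
  then show "integrable circ f"
    by (simp add: integrable_restrict_space set_integrable_def)
  show "integral\<^sup>L circ f = integral {0..2 * pi} f"
    using set_borel_integral_eq_integral(2)[OF \<open>set_integrable lborel {0..2 * pi} f\<close>]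
    by (simp add: integral_restrict_space set_lebesgue_integral_def)
qed

text \<open>On the closed unit disc \<open>1 - z * u\<close> has positive real part, so
  \<open>Ln (1 - z * u)\<close> is holomorphic there, with value 0 at the centre. Cauchy's formula
  makes its mean over the circle vanish, and the real part of the logarithm is the integrand. Since
  du/u = i dt, this real part appears as an imaginary part.\<close>

lemma has_integral_ln_cmod_one_minus_cis:
  assumes "cmod z < 1"
  shows "((\<lambda>t. ln (cmod (1 - z * cis t))) has_integral 0) {0..2 * pi}"
proof -
  have re: "Re (1 - z * u) > 0" if "cmod u \<le> 1" for u
  proof -
    have "cmod (z * u) < 1"
      using assms that by (metis mult_right_mono mult.commute mult_1 norm_ge_zero norm_mult order.strict_trans1)
    then show ?thesis
      using complex_Re_le_cmod[of "z * u"] by simp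
  qed
  have "(\<lambda>u. Ln (1 - z * u)) holomorphic_on cball 0 1"
    by (intro holomorphic_intros) (auto simp: complex_nonpos_Reals_iff dest!: re)
  from Cauchy_integral_circlepath_simple[OF this, of 0]
  have "((\<lambda>u. Ln (1 - z * u) / u) has_contour_integral 0) (part_circlepath 0 1 0 (2 * pi))"
    by (simp add: circlepath_def)
  then have "((\<lambda>t. Ln (1 - z * cis t) * \<i>) has_integral 0) {0..2 * pi}"
    by (subst (asm) has_contour_integral_part_circlepath_iff) (auto simp: mult_ac)
  from has_integral_linear[OF this bounded_linear_Im]
  have "((\<lambda>t. Re (Ln (1 - z * cis t))) has_integral 0) {0..2 * pi}"
    by (simp add: o_def)
  then show ?thesis
  proof (rule has_integral_eq[rotated])
    fix t
    have "1 - z * cis t \<noteq> 0"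
      using re[of "cis t"] by force
    then show "Re (Ln (1 - z * cis t)) = ln (cmod (1 - z * cis t))"
      by simp
  qed
qed

lemma cmod_cis_diff_eq: "cmod (cis t - z) = cmod (1 - cnj z * cis t)"
proof -
  have "cmod (cis t - z) = cmod (cnj (cis t) * (cis t - z))"
    by (simp add: norm_mult)
  also have "cnj (cis t) * (cis t - z) = cnj (1 - cnj z * cis t)"
    by (simp add: right_diff_distrib cis_cnj cis_mult)
  finally show ?thesis
    by (simp only: complex_mod_cnj)
qed

lemma jensen_off_circle:
  assumes "cmod z \<noteq> 1"
  shows "integrable circ (\<lambda>t. ln (cmod (cis t - z)))"
    and "integral\<^sup>L circ (\<lambda>t. ln (cmod (cis t - z))) = 2 * pi * ln (max 1 (cmod z))"
proof -
  have ne: "cis t \<noteq> z" for t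
    using assms by auto
  have cont: "continuous_on {0..2 * pi} (\<lambda>t. ln (cmod (cis t - z)))"
    using ne by (intro continuous_intros) auto
  show "integrable circ (\<lambda>t. ln (cmod (cis t - z)))"
    by (rule circ_continuous[OF cont])
  have "((\<lambda>t. ln (cmod (cis t - z))) has_integral 2 * pi * ln (max 1 (cmod z))) {0..2 * pi}"
  proof (cases "cmod z < 1")
    case True
    then show ?thesis
      using has_integral_ln_cmod_one_minus_cis[of "cnj z"] by (simp add: cmod_cis_diff_eq)
  next
    case False
    with assms have z: "cmod z > 1" by simp
    then have z0: "z \<noteq> 0" by auto
    have *: "ln (cmod (cis t - z)) = ln (cmod z) + ln (cmod (1 - inverse z * cis t))" for t
    proof -
      have "cis t - z = - z * (1 - inverse z * cis t)"
        using z0 by (simp add: field_simps)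
      moreover have "1 - inverse z * cis t \<noteq> 0"
        using ne[of t] z0 by (simp add: field_simps)
      ultimately show ?thesis
        using z0 by (simp add: norm_mult ln_mult)
    qed
    have "((\<lambda>t. ln (cmod z) + ln (cmod (1 - inverse z * cis t))) has_integral
             ((2 * pi - 0) *\<^sub>R ln (cmod z) + 0)) {0..2 * pi}"
      using z has_integral_const_real[of "ln (cmod z)" 0 "2 * pi"]
      by (intro has_integral_add has_integral_ln_cmod_one_minus_cis)
         (auto simp: norm_inverse inverse_less_1_iff)
    then show ?thesis
      using z by (simp add: * max_def)
  qed
  then show "integral\<^sup>L circ (\<lambda>t. ln (cmod (cis t - z))) = 2 * pi * ln (max 1 (cmod z))"
    using circ_continuous(2)[OF cont] by (simp add: integral_unique)
qed

lemma AE_circ_countable: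
  assumes "countable A"
  shows "AE t in circ. t \<notin> A"
proof -
  have "AE t in lborel. t \<notin> A"
    using countable_imp_null_set_lborel[OF assms] by (rule AE_not_in)
  then show ?thesis
    by (subst AE_restrict_space_iff) auto
qed

lemma countable_cis_eq: "countable {t. cis t = z}"
proof (cases "\<exists>t0. cis t0 = z")
  case True
  then obtain t0 where t0: "cis t0 = z" by blast
  have "{t. cis t = z} \<subseteq> range (\<lambda>k::int. t0 + 2 * pi * of_int k)"
  proof
    fix t assume "t \<in> {t. cis t = z}"
    then have "sin t = sin t0 \<and> cos t = cos t0"
      using t0 by (metis cis.sel mem_Collect_eq)
    then have "\<exists>k::int. t = t0 + 2 * pi * of_int k"
      by (subst (asm) sin_cos_eq_iff)
    then obtain k :: int where "t = t0 + 2 * pi * of_int k" ..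
    then show "t \<in> range (\<lambda>k::int. t0 + 2 * pi * of_int k)" by (rule range_eqI)
  qed
  then show ?thesis
    by (rule countable_subset) simp
qed auto

lemma AE_circ_cis_neq: "AE t in circ. cis t \<noteq> z"
  using AE_circ_countable[OF countable_cis_eq[of z]] by simp

lemma finite_measure_circ: "finite_measure circ"
  by (rule finite_measureI) (simp add: emeasure_restrict_space space_restrict_space)

interpretation circ: finite_measure circ
  by (rule finite_measure_circ)

lemma measure_circ: "measure circ (space circ) = 2 * pi"
  by (simp add: measure_restrict_space space_restrict_space)

lemma measurable_cis [measurable]: "cis \<in> borel_measurable borel"
  by (intro borel_measurable_continuous_onI continuous_intros)

text \<open>
  For \<open>\<bar>z\<bar> = 1\<close> the integrals over \<open>ln \<bar>e\<^sup>i\<^sup>t - rz\<bar>\<close> with \<open>r < 1\<close> converge: they are dominated since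
  \<open>\<bar>e\<^sup>i\<^sup>t - z\<bar> \<le> 2 \<bar>e\<^sup>i\<^sup>t - rz\<bar>\<close>, and Fatou's lemma gives the integrability of the limit.
\<close>

lemma jensen_on_circle:
  assumes z: "cmod z = 1"
  shows "integrable circ (\<lambda>t. ln (cmod (cis t - z)))"
    and "integral\<^sup>L circ (\<lambda>t. ln (cmod (cis t - z))) = 0"
proof -
  define r where "r n = 1 - 1 / real (n + 2)" for n
  define f where "f n t = ln (cmod (cis t - of_real (r n) * z))" for n t
  define g where "g t = ln (cmod (cis t - z))" for t
  have r: "0 < r n" "r n < 1" for n
    by (auto simp: r_def field_simps)
  have r_lim: "r \<longlonglongrightarrow> 1"
    unfolding r_def by real_asymp
  have norm_rz: "cmod (of_real (r n) * z) = r n" for n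
    using r[of n] z by (simp add: norm_mult)
  have f_int: "integrable circ (f n)" "integral\<^sup>L circ (f n) = 0" for n
    using jensen_off_circle[of "of_real (r n) * z"] r[of n]
    unfolding f_def norm_rz by (auto simp: max_def)
  have [measurable]: "f n \<in> borel_measurable circ" for n
    using f_int(1) by (rule borel_measurable_integrable)
  have f_le: "f n t \<le> ln 2" for n t
  proof -
    have "cmod (cis t - of_real (r n) * z) \<le> 2"
      using norm_triangle_ineq4[of "cis t" "of_real (r n) * z"] norm_rz[of n] r[of n] by simp
    moreover have "cmod (cis t - of_real (r n) * z) > 0"
      using norm_rz[of n] r[of n] norm_cis[of t] by (metis less_irrefl right_minus_eq zero_less_norm_iff)
    ultimately show ?thesis
      by (simp add: f_def)
  qed
  \<comment> \<open>Moving from \<open>z\<close> to \<open>r n * z\<close> costs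
    \<open>1 - r n\<close>, the distance from \<open>r n * z\<close> to the circle, and
    \<open>cis t\<close> lies on the circle. So this cost is at most the distance from
    \<open>cis t\<close> to \<open>r n * z\<close>, whence the factor 2.\<close>
  have f_ge: "f n t \<ge> g t - ln 2" if "cis t \<noteq> z" for n t
  proof -
    have "cmod (cis t - z) \<le> cmod (cis t - of_real (r n) * z) + cmod (of_real (r n) * z - z)"
      by (metis norm_triangle_ineq diff_add_cancel add_diff_eq)
    also have "of_real (r n) * z - z = of_real (r n - 1) * z"
      by (simp add: algebra_simps)
    also have "cmod \<dots> = 1 - r n"
      using r[of n] z by (simp add: norm_mult del: of_real_diff)
    also have "1 - r n \<le> cmod (cis t - of_real (r n) * z)"
      using norm_triangle_ineq2[of "cis t" "of_real (r n) * z"] norm_rz[of n] by simp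
    finally have "cmod (cis t - z) \<le> 2 * cmod (cis t - of_real (r n) * z)" by simp
    moreover have "cmod (cis t - z) > 0" using that by simp
    ultimately have "g t \<le> ln (2 * cmod (cis t - of_real (r n) * z))"
      unfolding g_def by (intro ln_mono) linarith+
    also have "\<dots> = ln 2 + f n t"
    proof -
      have "cmod (cis t - of_real (r n) * z) > 0"
        using \<open>cmod (cis t - z) > 0\<close> \<open>cmod (cis t - z) \<le> 2 * _\<close> by linarith
      then show ?thesis unfolding f_def by (subst ln_mult) auto
    qed
    finally show ?thesis by simp
  qed
  have f_lim: "(\<lambda>n. f n t) \<longlonglongrightarrow> g t" if "cis t \<noteq> z" for t
  proof -
    have "(\<lambda>n. ln (cmod (cis t - of_real (r n) * z))) \<longlonglongrightarrow> ln (cmod (cis t - of_real 1 * z))"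
      using that by (intro tendsto_intros r_lim) auto
    then show ?thesis
      by (simp add: f_def g_def)
  qed
  have meas: "g \<in> borel_measurable circ"
    unfolding g_def by (intro measurable_restrict_space1) measurable
  have g_le: "g t \<le> ln 2" if "cis t \<noteq> z" for t
    using f_lim[OF that] by (rule LIMSEQ_le_const2) (use f_le in auto)
  \<comment> \<open>All \<open>f n\<close> and \<open>g\<close> (off the point \<open>z\<close>) are
    bounded above by \<open>ln 2\<close>, so the reflected functions are nonnegative and Fatou's
    lemma applies; their integrals are all \<open>2 * pi * ln 2\<close>.\<close>
  have "integrable circ (\<lambda>t. ln 2 - g t)"
  proof (rule integrableI_bounded)
    have "(\<integral>\<^sup>+ t. ennreal (norm (ln 2 - g t)) \<partial>circ) = (\<integral>\<^sup>+ t. liminf (\<lambda>n. ennreal (ln 2 - f n t)) \<partial>circ)"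
    proof (rule nn_integral_cong_AE)
      show "AE t in circ. ennreal (norm (ln 2 - g t)) = liminf (\<lambda>n. ennreal (ln 2 - f n t))"
        using AE_circ_cis_neq[of z]
      proof eventually_elim
        case (elim t)
        have "(\<lambda>n. ennreal (ln 2 - f n t)) \<longlonglongrightarrow> ennreal (ln 2 - g t)"
          by (intro tendsto_intros f_lim elim)
        then have "liminf (\<lambda>n. ennreal (ln 2 - f n t)) = ennreal (ln 2 - g t)"
          by (intro lim_imp_Liminf) auto
        then show ?case
          using g_le[OF elim] by simp
      qed
    qed
    also have "\<dots> \<le> liminf (\<lambda>n. \<integral>\<^sup>+ t. ennreal (ln 2 - f n t) \<partial>circ)"
      by (intro nn_integral_liminf) measurable
    also have "(\<lambda>n. \<integral>\<^sup>+ t. ennreal (ln 2 - f n t) \<partial>circ) = (\<lambda>n. ennreal (2 * pi * ln 2))"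
    proof
      fix n
      show "(\<integral>\<^sup>+ t. ennreal (ln 2 - f n t) \<partial>circ) = ennreal (2 * pi * ln 2)"
        using f_int[of n] f_le[of n] measure_circ
        by (subst nn_integral_eq_integral) (auto intro!: Bochner_Integration.integrable_diff)
    qed
    finally show "(\<integral>\<^sup>+ t. ennreal (norm (ln 2 - g t)) \<partial>circ) < \<infinity>"
      by (simp add: Liminf_const order_le_less_trans)
  qed (use meas in measurable)
  then have "integrable circ (\<lambda>t. ln 2 - (ln 2 - g t))"
    by (rule Bochner_Integration.integrable_diff[rotated]) simp
  then have g_int: "integrable circ g"
    by (simp only: diff_diff_eq2 add_diff_cancel_left')
  then show "integrable circ (\<lambda>t. ln (cmod (cis t - z)))"
    by (simp add: g_def[abs_def])
  have "(\<lambda>n. integral\<^sup>L circ (f n)) \<longlonglongrightarrow> integral\<^sup>L circ g"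
  proof (rule integral_dominated_convergence[where w = "\<lambda>t. \<bar>g t\<bar> + ln 2"])
    show "AE t in circ. (\<lambda>n. f n t) \<longlonglongrightarrow> g t"
      using AE_circ_cis_neq[of z] by eventually_elim (rule f_lim)
    show "AE t in circ. norm (f n t) \<le> \<bar>g t\<bar> + ln 2" for n
      using AE_circ_cis_neq[of z]
    proof eventually_elim
      case (elim t)
      then show ?case
        using f_ge[OF elim, of n] f_le[of n t] unfolding real_norm_def by linarith
    qed
  qed (use f_int g_int meas in auto)
  then have "integral\<^sup>L circ g = 0"
    using f_int by (simp add: LIMSEQ_const_iff)
  then show "integral\<^sup>L circ (\<lambda>t. ln (cmod (cis t - z))) = 0"
    by (simp add: g_def[abs_def])
qed

lemma jensen_linear:
  "integrable circ (\<lambda>t. ln (cmod (cis t - z)))"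
  "integral\<^sup>L circ (\<lambda>t. ln (cmod (cis t - z))) = 2 * pi * ln (max 1 (cmod z))"
  using jensen_off_circle[of z] jensen_on_circle[of z] by (cases "cmod z = 1"; simp)+

text \<open>This is the logarithmic Mahler measure of the quadratic
  \<open>w\<^sup>2 + 2 * x * w + 1\<close> in \<open>w\<close>: it vanishes when both roots lie on
  the unit circle and otherwise is the logarithm of the modulus of the larger root.\<close>

definition arcosh_max :: "real \<Rightarrow> real" where
  "arcosh_max x = arcosh (max 1 \<bar>x\<bar>)"

text \<open>The roots have product 1. For \<open>\<bar>B\<bar> \<le> 2\<close> they are conjugate
  points of the unit circle; otherwise they are real, of the form \<sigma>u and \<sigma>/u with
  \<open>u > 1\<close> and sign \<sigma> opposite to \<open>B\<close>, and \<open>ln u\<close> is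
  the explicit formula for arcosh at \<open>\<bar>B\<bar> / 2\<close>.\<close>

lemma reciprocal_quadratic_roots:
  fixes B :: real
  obtains w1 w2 :: complex where "\<And>w. w\<^sup>2 + of_real B * w + 1 = (w - w1) * (w - w2)"
    "ln (max 1 (cmod w1)) + ln (max 1 (cmod w2)) = arcosh_max (B / 2)"
proof (cases "\<bar>B\<bar> \<le> 2")
  case True
  define w where "w = Complex (- B / 2) (sqrt (1 - (B / 2)\<^sup>2))"
  have B: "(B / 2)\<^sup>2 \<le> 1"
    using True by (simp add: abs_square_le_1)
  then have cw: "cmod w = 1"
    by (simp add: w_def cmod_def)
  have eq: "x\<^sup>2 + of_real B * x + 1 = (x - w) * (x - cnj w)" for x
  proof -
    have "(x - w) * (x - cnj w) = x\<^sup>2 - (w + cnj w) * x + w * cnj w"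
      by (simp add: algebra_simps power2_eq_square)
    moreover have "w + cnj w = - of_real B"
      by (simp add: w_def complex_eq_iff)
    moreover have "w * cnj w = 1"
      using cw by (simp flip: complex_norm_square)
    ultimately show ?thesis by simp
  qed
  show thesis
    by (rule that[OF eq]) (use cw True in \<open>simp_all add: arcosh_max_def\<close>)
next
  case False
  define d where "d = sqrt ((B / 2)\<^sup>2 - 1)"
  define u where "u = \<bar>B / 2\<bar> + d"
  have B: "\<bar>B / 2\<bar> > 1" using False by simp
  have B2: "(B / 2)\<^sup>2 > 1"
    using B by (metis abs_square_less_1 abs_square_le_1 linorder_not_less nless_le power2_abs not_less_iff_gr_or_eq)
  then have d2: "d\<^sup>2 = (B / 2)\<^sup>2 - 1" and d0: "d \<ge> 0"
    by (simp_all add: d_def)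
  have uv: "u * (\<bar>B / 2\<bar> - d) = 1"
    using d2 by (simp add: u_def algebra_simps power2_eq_square)
  have u1: "u > 1" using B d0 by (simp add: u_def)
  define \<sigma> where "\<sigma> = - sgn B"
  have \<sigma>: "\<sigma> * \<bar>B\<bar> = - B" "\<sigma> * \<sigma> = 1" "\<bar>\<sigma>\<bar> = 1"
    using False by (auto simp: \<sigma>_def sgn_if)
  have eq: "w\<^sup>2 + of_real B * w + 1 = (w - of_real (\<sigma> * u)) * (w - of_real (\<sigma> / u))" for w :: complex
  proof -
    have "1 / u = \<bar>B / 2\<bar> - d"
      using uv u1 by (simp add: divide_eq_eq mult.commute)
    then have "\<sigma> * u + \<sigma> / u = \<sigma> * (u + (\<bar>B / 2\<bar> - d))"
      by (metis distrib_left times_divide_eq_right mult.right_neutral)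
    also have "\<dots> = \<sigma> * \<bar>B\<bar>"
      by (simp add: u_def)
    also have "\<dots> = - B" by (fact \<sigma>(1))
    finally have s: "\<sigma> * u + \<sigma> / u = - B" .
    have p: "\<sigma> * u * (\<sigma> / u) = 1"
      using \<sigma>(2) u1 by simp
    have "(w - of_real (\<sigma> * u)) * (w - of_real (\<sigma> / u))
      = w\<^sup>2 - of_real (\<sigma> * u + \<sigma> / u) * w + of_real (\<sigma> * u * (\<sigma> / u))"
      by (simp add: algebra_simps power2_eq_square)
    then show ?thesis
      unfolding s p by simp
  qed
  have "cmod (of_real (\<sigma> * u)) = u" "cmod (of_real (\<sigma> / u)) = 1 / u"
    using u1 \<sigma>(3) by (simp_all only: norm_of_real abs_mult abs_divide)
  moreover have "arcosh_max (B / 2) = ln u"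
    using B unfolding arcosh_max_def u_def d_def
    by (subst arcosh_real_def) (auto simp: max_def power_divide)
  ultimately show thesis
    using that[OF eq] u1 by (simp add: max_def)
qed

text \<open>For \<open>w = cis (t - \<phi>)\<close> the quadratic divided by \<open>w\<close> is the
  real number \<open>2 * cos (t - \<phi>) + B\<close>. The phase \<phi> only rotates the roots, so
  their moduli, and hence the mean, do not depend on it.\<close>

lemma jensen_cos:
  fixes B \<phi> :: real
  shows "AE t in circ. 2 * cos (t - \<phi>) + B \<noteq> 0"
    and "integrable circ (\<lambda>t. ln \<bar>2 * cos (t - \<phi>) + B\<bar>)"
    and "integral\<^sup>L circ (\<lambda>t. ln \<bar>2 * cos (t - \<phi>) + B\<bar>) = 2 * pi * arcosh_max (B / 2)"
proof -
  obtain w1 w2 where eq: "\<And>w. w\<^sup>2 + of_real B * w + 1 = (w - w1) * (w - w2)"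
    and m: "ln (max 1 (cmod w1)) + ln (max 1 (cmod w2)) = arcosh_max (B / 2)"
    by (rule reciprocal_quadratic_roots[of B]) blast
  define z1 where "z1 = cis \<phi> * w1"
  define z2 where "z2 = cis \<phi> * w2"
  have abs: "\<bar>2 * cos (t - \<phi>) + B\<bar> = cmod (cis t - z1) * cmod (cis t - z2)" for t
  proof -
    define w where "w = cis (t - \<phi>)"
    have "w * cnj w = 1" by (simp add: w_def flip: complex_norm_square)
    then have "w\<^sup>2 + of_real B * w + 1 = w * (w + cnj w + of_real B)"
      by (simp add: algebra_simps power2_eq_square)
    also have "w + cnj w + of_real B = of_real (2 * cos (t - \<phi>) + B)"
      by (simp add: w_def complex_eq_iff)
    finally have "cmod ((w - w1) * (w - w2)) = \<bar>2 * cos (t - \<phi>) + B\<bar>"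
      unfolding eq by (simp only: norm_mult norm_of_real) (simp add: w_def)
    moreover have "cis t - z1 = cis \<phi> * (w - w1)" "cis t - z2 = cis \<phi> * (w - w2)"
      by (simp_all add: z1_def z2_def w_def algebra_simps cis_mult)
    ultimately show ?thesis
      by (simp add: norm_mult)
  qed
  have ae: "AE t in circ. cis t \<noteq> z1 \<and> cis t \<noteq> z2"
    using AE_circ_cis_neq[of z1] AE_circ_cis_neq[of z2] by eventually_elim simp
  then show "AE t in circ. 2 * cos (t - \<phi>) + B \<noteq> 0"
  proof eventually_elim
    case (elim t)
    then show ?case using abs[of t] by auto
  qed
  \<comment> \<open>At a zero of one factor the product rule for \<open>ln\<close> can fail under
    the convention \<open>ln 0 = 0\<close>, so the identity is only claimed off a null set.\<close>
  have ae': "AE t in circ. ln (cmod (cis t - z1)) + ln (cmod (cis t - z2)) = ln \<bar>2 * cos (t - \<phi>) + B\<bar>"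
    using ae by eventually_elim (simp add: abs ln_mult)
  have meas: "(\<lambda>t. ln \<bar>2 * cos (t - \<phi>) + B\<bar>) \<in> borel_measurable circ"
    by (intro measurable_restrict_space1) measurable
  have "integrable circ (\<lambda>t. ln (cmod (cis t - z1)) + ln (cmod (cis t - z2)))"
    by (intro Bochner_Integration.integrable_add jensen_linear)
  then show "integrable circ (\<lambda>t. ln \<bar>2 * cos (t - \<phi>) + B\<bar>)"
    using meas by (subst integrable_cong_AE[OF _ _ ae', symmetric]) auto
  have "integral\<^sup>L circ (\<lambda>t. ln \<bar>2 * cos (t - \<phi>) + B\<bar>)
      = integral\<^sup>L circ (\<lambda>t. ln (cmod (cis t - z1)) + ln (cmod (cis t - z2)))"
    using meas ae' by (intro integral_cong_AE) (auto intro!: borel_measurable_add jensen_linear(1)[THEN borel_measurable_integrable])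
  also have "\<dots> = 2 * pi * ln (max 1 (cmod w1)) + 2 * pi * ln (max 1 (cmod w2))"
    by (subst Bochner_Integration.integral_add) (simp_all add: jensen_linear z1_def z2_def norm_mult)
  finally show "integral\<^sup>L circ (\<lambda>t. ln \<bar>2 * cos (t - \<phi>) + B\<bar>) = 2 * pi * arcosh_max (B / 2)"
    unfolding m[symmetric] by (simp add: algebra_simps)
qed

subsection \<open>Change of variables for nonnegative integrands\<close>

text \<open>Both sides may be infinite. A nonnegative integral is finite exactly when the integrand
  is absolutely integrable, and this property is transported by \<open>g\<close> in both directions;
  in the finite case the two integrals are then compared as real numbers.\<close>

lemma nn_integral_change_of_variables:
  fixes f g g' :: "real \<Rightarrow> real"
  assumes S: "S \<in> sets borel" and T: "g ` S \<in> sets borel"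
    and der: "\<And>x. x \<in> S \<Longrightarrow> (g has_field_derivative g' x) (at x)"
    and inj: "inj_on g S"
    and meas: "f \<in> borel_measurable borel" "g \<in> borel_measurable borel" "g' \<in> borel_measurable borel"
    and nonneg: "\<And>y. y \<in> g ` S \<Longrightarrow> f y \<ge> 0"
  shows "(\<integral>\<^sup>+ x\<in>S. ennreal (\<bar>g' x\<bar> * f (g x)) \<partial>lborel) = (\<integral>\<^sup>+ y\<in>g ` S. ennreal (f y) \<partial>lborel)"
proof -
  have meas': "(\<lambda>x. \<bar>g' x\<bar> * f (g x)) \<in> borel_measurable borel"
    using meas by measurable
  have nn: "(\<integral>\<^sup>+ x\<in>A. ennreal (h x) \<partial>lborel) =
      (if h absolutely_integrable_on A then ennreal (integral A h) else \<infinity>)"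
    if A: "A \<in> sets borel" and h: "h \<in> borel_measurable borel" and h0: "\<And>x. x \<in> A \<Longrightarrow> h x \<ge> 0"
    for A and h :: "real \<Rightarrow> real"
  proof -
    have eq: "(\<integral>\<^sup>+ x\<in>A. ennreal (h x) \<partial>lborel) = (\<integral>\<^sup>+ x. ennreal (indicator A x * h x) \<partial>lborel)"
      by (intro nn_integral_cong) (auto simp: indicator_def)
    have ind0: "indicator A x * h x \<ge> 0" for x
      using h0 by (auto simp: indicator_def)
    have m: "(\<lambda>x. indicator A x * h x) \<in> borel_measurable borel"
      using A h by measurable
    have iff: "h absolutely_integrable_on A \<longleftrightarrow> integrable lborel (\<lambda>x. indicator A x * h x)"
      using m by (simp add: set_integrable_def integrable_completion)
    show ?thesis
    proof (cases "integrable lborel (\<lambda>x. indicator A x * h x)")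
      case True
      then have "set_integrable lborel A h"
        by (simp add: set_integrable_def)
      from set_borel_integral_eq_integral(2)[OF this]
      have "integral A h = integral\<^sup>L lborel (\<lambda>x. indicator A x * h x)"
        by (simp add: set_lebesgue_integral_def)
      with True show ?thesis
        unfolding eq iff by (simp add: nn_integral_eq_integral ind0)
    next
      case False
      then have "(\<integral>\<^sup>+ x. ennreal (indicator A x * h x) \<partial>lborel) = \<infinity>"
        using m ind0 by (simp add: integrable_iff_bounded) (metis top.not_eq_extremum)
      with False show ?thesis
        unfolding eq iff by simp
    qed
  qed
  have cv: "(\<lambda>x. \<bar>g' x\<bar> * f (g x)) absolutely_integrable_on S \<and> integral S (\<lambda>x. \<bar>g' x\<bar> * f (g x)) = b
     \<longleftrightarrow> f absolutely_integrable_on (g ` S) \<and> integral (g ` S) f = b" for b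
    using S der inj by (intro has_absolute_integral_change_of_variables_1') (auto intro: has_field_derivative_at_within)
  then have "(\<lambda>x. \<bar>g' x\<bar> * f (g x)) absolutely_integrable_on S \<longleftrightarrow> f absolutely_integrable_on (g ` S)"
    by blast
  moreover have "integral S (\<lambda>x. \<bar>g' x\<bar> * f (g x)) = integral (g ` S) f"
    if "f absolutely_integrable_on (g ` S)"
    using cv[of "integral (g ` S) f"] that by blast
  ultimately show ?thesis
    using nn[OF S meas'] nn[OF T meas(1) nonneg] nonneg by auto
qed

lemma nn_integral_change_of_variables_increasing:
  fixes f g g' :: "real \<Rightarrow> real"
  assumes ab: "a < b" and cont: "continuous_on {a..b} g"
    and der: "\<And>x. x \<in> {a<..<b} \<Longrightarrow> (g has_field_derivative g' x) (at x)"
    and pos: "\<And>x. x \<in> {a<..<b} \<Longrightarrow> g' x > 0"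
    and meas: "f \<in> borel_measurable borel" "g \<in> borel_measurable borel" "g' \<in> borel_measurable borel"
    and nonneg: "\<And>y. y \<in> {g a<..<g b} \<Longrightarrow> f y \<ge> 0"
  shows "(\<integral>\<^sup>+ x\<in>{a<..<b}. ennreal (g' x * f (g x)) \<partial>lborel) = (\<integral>\<^sup>+ y\<in>{g a<..<g b}. ennreal (f y) \<partial>lborel)"
proof -
  have mono: "g x < g y" if "a \<le> x" "x < y" "y \<le> b" for x y
  proof (rule DERIV_pos_imp_increasing_open[OF that(2)])
    show "\<exists>z. DERIV g u :> z \<and> z > 0" if "x < u" "u < y" for u
      using der[of u] pos[of u] that \<open>a \<le> x\<close> \<open>y \<le> b\<close> by (intro exI[of _ "g' u"]) auto
    show "continuous_on {x..y} g"
      using cont that by (rule_tac continuous_on_subset) auto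
  qed
  have im: "g ` {a<..<b} = {g a<..<g b}"
  proof
    show "{g a<..<g b} \<subseteq> g ` {a<..<b}"
    proof
      fix y assume y: "y \<in> {g a<..<g b}"
      then obtain x where "a \<le> x" "x \<le> b" "g x = y"
        using IVT'[of g a y b] ab cont by auto
      with y show "y \<in> g ` {a<..<b}"
        by (intro image_eqI[of _ _ x]) (auto simp: less_le)
    qed
  qed (auto intro!: mono)
  have inj: "inj_on g {a<..<b}"
  proof (rule linorder_inj_onI)
    show "g x \<noteq> g y" if "x < y" "x \<in> {a<..<b}" "y \<in> {a<..<b}" for x y
      using mono[of x y] that by auto
  qed auto
  have "(\<integral>\<^sup>+ x\<in>{a<..<b}. ennreal (g' x * f (g x)) \<partial>lborel)
      = (\<integral>\<^sup>+ x\<in>{a<..<b}. ennreal (\<bar>g' x\<bar> * f (g x)) \<partial>lborel)"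
    by (intro nn_integral_cong) (use pos in \<open>auto simp: indicator_def abs_of_pos\<close>)
  also have "\<dots> = (\<integral>\<^sup>+ y\<in>g ` {a<..<b}. ennreal (f y) \<partial>lborel)"
    by (rule nn_integral_change_of_variables) (use im der inj meas nonneg in auto)
  finally show ?thesis
    by (simp add: im)
qed

lemma nn_integral_change_of_variables_decreasing:
  fixes f g g' :: "real \<Rightarrow> real"
  assumes ab: "a < b" and cont: "continuous_on {a..b} g"
    and der: "\<And>x. x \<in> {a<..<b} \<Longrightarrow> (g has_field_derivative - g' x) (at x)"
    and pos: "\<And>x. x \<in> {a<..<b} \<Longrightarrow> g' x > 0"
    and meas: "f \<in> borel_measurable borel" "g \<in> borel_measurable borel" "g' \<in> borel_measurable borel"
    and nonneg: "\<And>y. y \<in> {g b<..<g a} \<Longrightarrow> f y \<ge> 0"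
  shows "(\<integral>\<^sup>+ x\<in>{a<..<b}. ennreal (g' x * f (g x)) \<partial>lborel) = (\<integral>\<^sup>+ y\<in>{g b<..<g a}. ennreal (f y) \<partial>lborel)"
proof -
  have neg: "(\<integral>\<^sup>+ y\<in>{u<..<v}. h y \<partial>lborel) = (\<integral>\<^sup>+ y\<in>{-v<..<-u}. h (- y) \<partial>lborel)"
    if [measurable]: "h \<in> borel_measurable borel" for u v :: real and h :: "real \<Rightarrow> ennreal"
    by (subst nn_integral_real_affine[where c = "-1" and t = 0])
       (auto intro!: nn_integral_cong simp: indicator_def split: if_splits)
  have [measurable]: "f \<in> borel_measurable borel" by fact
  have "(\<integral>\<^sup>+ x\<in>{a<..<b}. ennreal (g' x * f (- (- g x))) \<partial>lborel)
      = (\<integral>\<^sup>+ y\<in>{- g a<..<- g b}. ennreal (f (- y)) \<partial>lborel)"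
    using ab cont meas
    by (intro nn_integral_change_of_variables_increasing pos nonneg continuous_intros)
       (auto intro!: derivative_eq_intros der pos nonneg)
  also have "\<dots> = (\<integral>\<^sup>+ y\<in>{g b<..<g a}. ennreal (f y) \<partial>lborel)"
    by (subst neg[of "\<lambda>y. ennreal (f y)"]) auto
  finally show ?thesis by simp
qed

subsection \<open>Reduction to one-dimensional integrals\<close>

text \<open>The logarithm is bounded above by \<open>C\<close> but not below. Fubini's theorem still
  applies, because \<open>\<bar>f\<bar> \<le> 2 * C - f\<close> whenever \<open>f \<le> C\<close>
  and \<open>C \<ge> 0\<close>, and the inner integral of the right-hand side is known through
  \<open>J\<close>.\<close>

lemma mahler_measure_iterated:
  assumes meas: "(\<lambda>z. F (cis (fst z)) (cis (snd z))) \<in> borel_measurable borel"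
    and C: "\<And>s t. ln (cmod (F (cis s) (cis t))) \<le> C" "C \<ge> 0"
    and inner: "AE s in circ. integrable circ (\<lambda>t. ln (cmod (F (cis s) (cis t)))) \<and>
           integral\<^sup>L circ (\<lambda>t. ln (cmod (F (cis s) (cis t)))) = 2 * pi * J s"
    and J: "integrable circ J"
  shows "mahler_measure F = 1 / (2 * pi) * integral\<^sup>L circ J"
proof -
  define f where "f s t = ln (cmod (F (cis s) (cis t)))" for s t
  define I :: "real \<Rightarrow> real" where "I = indicator {0..2 * pi}"
  define G where "G z = I (fst z) * (I (snd z) * f (fst z) (snd z))" for z
  have circ_int: "integral\<^sup>L circ h = (\<integral>x. I x * h x \<partial>lborel)" for h :: "real \<Rightarrow> real"
    by (simp add: integral_restrict_space I_def)
  have circ_integrable: "integrable circ h \<longleftrightarrow> integrable lborel (\<lambda>x. I x * h x)" for h :: "real \<Rightarrow> real"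
    by (simp add: integrable_restrict_space I_def)
  have AE_circ: "(AE x in circ. P x) \<longleftrightarrow> (AE x in lborel. x \<in> {0..2 * pi} \<longrightarrow> P x)" for P
    by (subst AE_restrict_space_iff) auto
  have I: "I x = 0 \<or> I x = 1" "I x \<ge> 0" "x \<notin> {0..2 * pi} \<Longrightarrow> I x = 0" for x
    by (auto simp: I_def indicator_def)
  have [measurable]: "I \<in> borel_measurable borel"
    by (simp add: I_def)
  have [measurable]: "(\<lambda>z. f (fst z) (snd z)) \<in> borel_measurable (borel \<Otimes>\<^sub>M borel)"
    using meas unfolding f_def by (simp add: borel_prod)
  have Gm [measurable]: "G \<in> borel_measurable (lborel \<Otimes>\<^sub>M lborel)"
    unfolding G_def[abs_def] by measurable
  have inner': "AE s in lborel. s \<in> {0..2 * pi} \<longrightarrow> integrable circ (f s) \<and> integral\<^sup>L circ (f s) = 2 * pi * J s"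
    using inner unfolding AE_circ f_def[abs_def] .
  have "integrable (lborel \<Otimes>\<^sub>M lborel) G"
  proof (rule lborel_pair.Fubini_integrable)
    show "AE s in lborel. integrable lborel (\<lambda>t. G (s, t))"
      using inner' by eventually_elim (use I in \<open>fastforce simp: G_def circ_integrable\<close>)
    have "integrable circ (\<lambda>s. 2 * C * (2 * pi) - 2 * pi * J s)"
      using J by (intro Bochner_Integration.integrable_diff integrable_mult_right) auto
    then show "integrable lborel (\<lambda>s. \<integral>t. norm (G (s, t)) \<partial>lborel)"
      unfolding circ_integrable
    proof (rule Bochner_Integration.integrable_bound)
      show "(\<lambda>s. \<integral>t. norm (G (s, t)) \<partial>lborel) \<in> borel_measurable lborel"
        by measurable
      show "AE s in lborel. norm (\<integral>t. norm (G (s, t)) \<partial>lborel)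
              \<le> norm (I s * (2 * C * (2 * pi) - 2 * pi * J s))"
        using inner'
      proof eventually_elim
        case (elim s)
        show ?case
        proof (cases "s \<in> {0..2 * pi}")
          case True
          then have Is: "I s = 1" by (simp add: I_def)
          have int: "integrable circ (f s)" and eq: "integral\<^sup>L circ (f s) = 2 * pi * J s"
            using elim True by auto
          have "(\<integral>t. norm (G (s, t)) \<partial>lborel) = integral\<^sup>L circ (\<lambda>t. \<bar>f s t\<bar>)"
            unfolding circ_int
            by (intro Bochner_Integration.integral_cong) (auto simp: G_def Is abs_mult I)
          also have "\<dots> \<le> integral\<^sup>L circ (\<lambda>t. 2 * C - f s t)"
          proof (intro integral_mono integrable_abs int Bochner_Integration.integrable_diff)
            show "\<bar>f s t\<bar> \<le> 2 * C - f s t" for t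
              using C(1)[of s t] C(2) unfolding f_def[symmetric] by linarith
          qed auto
          also have "\<dots> = 2 * C * (2 * pi) - 2 * pi * J s"
            using int eq measure_circ by (subst Bochner_Integration.integral_diff) auto
          finally have "(\<integral>t. norm (G (s, t)) \<partial>lborel) \<le> 2 * C * (2 * pi) - 2 * pi * J s" .
          moreover have "(\<integral>t. norm (G (s, t)) \<partial>lborel) \<ge> 0" by simp
          ultimately show ?thesis by (simp add: Is)
        qed (simp add: G_def I)
      qed
    qed
  qed measurable
  then have "integral\<^sup>L (lborel \<Otimes>\<^sub>M lborel) G = (\<integral>s. \<integral>t. G (s, t) \<partial>lborel \<partial>lborel)"
    by (rule lborel_pair.integral_fst'[symmetric])
  also have "\<dots> = (\<integral>s. I s * (2 * pi * J s) \<partial>lborel)"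
  proof (rule integral_cong_AE)
    show "(\<lambda>s. I s * (2 * pi * J s)) \<in> borel_measurable lborel"
      using J[unfolded circ_integrable, THEN borel_measurable_integrable, THEN borel_measurable_times[OF borel_measurable_const[of "2 * pi"]]]
      by (simp add: mult_ac)
    show "AE s in lborel. (\<integral>t. G (s, t) \<partial>lborel) = I s * (2 * pi * J s)"
      using inner' by eventually_elim (use I in \<open>fastforce simp: G_def circ_int\<close>)
  qed measurable
  also have "\<dots> = (\<integral>s. 2 * pi * (I s * J s) \<partial>lborel)"
    by (intro Bochner_Integration.integral_cong) auto
  also have "\<dots> = 2 * pi * integral\<^sup>L circ J"
    by (simp add: circ_int)
  finally have G: "integral\<^sup>L (lborel \<Otimes>\<^sub>M lborel) G = 2 * pi * integral\<^sup>L circ J" .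
  have "(LINT (s, t) : {0..2 * pi} \<times> {0..2 * pi} | lborel. ln (cmod (F (cis s) (cis t))))
      = integral\<^sup>L (lborel \<Otimes>\<^sub>M lborel) G"
    unfolding set_lebesgue_integral_def lborel_prod
    by (intro Bochner_Integration.integral_cong)
       (auto simp: G_def f_def I_def indicator_def split: if_splits)
  then show ?thesis
    unfolding mahler_measure_def G by (simp add: power2_eq_square)
qed

lemma arcosh_max_continuous: "continuous_on A arcosh_max"
  unfolding arcosh_max_def[abs_def] by (intro continuous_intros) auto

lemma measurable_arcosh_max [measurable]: "arcosh_max \<in> borel_measurable borel"
  by (intro borel_measurable_continuous_onI arcosh_max_continuous)

lemma arcosh_max_nonneg: "arcosh_max x \<ge> 0"
  by (simp add: arcosh_max_def)

lemma arcosh_max_le_1: "\<bar>x\<bar> \<le> 1 \<Longrightarrow> arcosh_max x = 0"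
  by (simp add: arcosh_max_def)

lemma arcosh_max_minus: "arcosh_max (- x) = arcosh_max x"
  by (simp add: arcosh_max_def)

lemma arcosh_max_le_ln: "arcosh_max x \<le> ln (2 * max 1 \<bar>x\<bar>)"
proof -
  define m where "m = max 1 \<bar>x\<bar>"
  have m: "m \<ge> 1" by (simp add: m_def)
  have "sqrt (m\<^sup>2 - 1) \<le> sqrt (m\<^sup>2)" by (rule real_sqrt_le_mono) simp
  then have "m + sqrt (m\<^sup>2 - 1) \<le> 2 * m" using m by simp
  moreover have "sqrt (m\<^sup>2 - 1) \<ge> 0" using m by simp
  ultimately have "ln (m + sqrt (m\<^sup>2 - 1)) \<le> ln (2 * m)"
    using m by (intro ln_mono) linarith+
  then show ?thesis
    using m unfolding arcosh_max_def m_def[symmetric] by (simp add: arcosh_real_def)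
qed

section \<open>The two polynomials on the torus\<close>

lemma S_poly_cmod:
  "cmod (S_poly \<alpha> (cis s) (cis t)) = \<bar>2 * cos (t - 2 * s) + (2 * cos (2 * s) + 2 * \<alpha> * (1 + cos s))\<bar>"
proof -
  have c2: "cis (- s) = cnj (cis s)" for s by (simp add: cis_cnj)
  define x where "x = cis s"
  define y where "y = cis t"
  have xx: "x * cnj x = 1" and yy: "y * cnj y = 1"
    by (simp_all add: x_def y_def flip: complex_norm_square)
  \<comment> \<open>The coefficients of the quartic family are symmetric about the monomial
    \<open>x\<^sup>2 * y\<close>; dividing by it pairs every term with its conjugate.\<close>
  define w where "w = y * cnj x ^ 2"
  have xs: "x ^ 4 * cnj x ^ 2 = x ^ 2" "x ^ 3 * cnj x ^ 2 = x" "x ^ 2 * cnj x ^ 2 = 1"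
    using xx by algebra+
  have "S_poly \<alpha> x y * (cnj y * cnj x ^ 2)
     = w + cnj w + (x ^ 2 + cnj x ^ 2) + of_real \<alpha> * (x + cnj x + 2)"
  proof -
    have "S_poly \<alpha> x y * (cnj y * cnj x ^ 2)
      = y * (y * cnj y) * cnj x ^ 2
        + (x ^ 4 * cnj x ^ 2 + of_real \<alpha> * (x ^ 3 * cnj x ^ 2) + 2 * of_real \<alpha> * (x ^ 2 * cnj x ^ 2)
           + of_real \<alpha> * (x * cnj x) * cnj x + cnj x ^ 2) * (y * cnj y) + x ^ 4 * cnj x ^ 2 * cnj y"
      unfolding S_poly_def by (simp add: algebra_simps power2_eq_square)
    then show ?thesis
      unfolding xs xx yy w_def by (simp add: algebra_simps)
  qed
  also have "\<dots> = of_real (2 * cos (t - 2 * s) + (2 * cos (2 * s) + 2 * \<alpha> * (1 + cos s)))"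
  proof -
    have x2: "x ^ 2 = cis (2 * s)"
      by (simp add: x_def Complex.DeMoivre)
    have "w = cis (t - 2 * s)"
      by (simp add: w_def x_def y_def cis_cnj Complex.DeMoivre cis_mult)
    then have "w + cnj w = of_real (2 * cos (t - 2 * s))"
      by (simp add: complex_eq_iff)
    moreover have "x ^ 2 + cnj x ^ 2 = of_real (2 * cos (2 * s))"
      by (simp add: complex_eq_iff x2 flip: complex_cnj_power)
    moreover have "x + cnj x = of_real (2 * cos s)"
      by (simp add: complex_eq_iff x_def)
    ultimately show ?thesis
      by (simp add: algebra_simps)
  qed
  finally have "cmod (S_poly \<alpha> x y * (cnj y * cnj x ^ 2)) = \<bar>2 * cos (t - 2 * s) + (2 * cos (2 * s) + 2 * \<alpha> * (1 + cos s))\<bar>"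
    by (simp only: norm_of_real)
  then show ?thesis
    by (simp add: norm_mult norm_power x_def y_def)
qed

lemma P_poly_cmod:
  "cmod (P_poly \<alpha> (cis s) (cis t))
     = \<bar>2 * (2 * cos (s / 2)) * cos (t - s / 2) + (2 * cos (s / 2))\<^sup>2 - \<alpha>\<bar>"
proof -
  \<comment> \<open>With \<open>x = u\<^sup>2\<close>, the factor \<open>x + 1\<close> is
    \<open>u * (u + cnj u)\<close>, and \<open>(y + 1) * (x + y)\<close> is \<open>u * y\<close>
    times \<open>(u + cnj u) + (w + cnj w)\<close>, where \<open>w = y * cnj u\<close>. Half angles
    thus make both factors real after division by \<open>x * y\<close>.\<close>
  define u where "u = cis (s / 2)"
  define y where "y = cis t"
  have uu: "u * cnj u = 1" and yy: "y * cnj y = 1"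
    by (simp_all add: u_def y_def flip: complex_norm_square)
  have x: "cis s = u ^ 2"
    by (simp add: u_def Complex.DeMoivre)
  define w where "w = y * cnj u"
  have "P_poly \<alpha> (u ^ 2) y * (cnj y * cnj u ^ 2)
      = (u + cnj u) * (w + cnj w) + (u + cnj u)\<^sup>2 - of_real \<alpha>"
    unfolding P_poly_def w_def using uu yy by (simp, algebra)
  also have "\<dots> = of_real (2 * (2 * cos (s / 2)) * cos (t - s / 2) + (2 * cos (s / 2))\<^sup>2 - \<alpha>)"
  proof -
    have "u + cnj u = of_real (2 * cos (s / 2))"
      by (simp add: u_def complex_eq_iff)
    moreover have "w = cis (t - s / 2)"
      by (simp add: w_def u_def y_def cis_cnj cis_mult)
    then have "w + cnj w = of_real (2 * cos (t - s / 2))"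
      by (simp add: complex_eq_iff)
    ultimately show ?thesis by simp
  qed
  finally have "cmod (P_poly \<alpha> (u ^ 2) y * (cnj y * cnj u ^ 2))
      = \<bar>2 * (2 * cos (s / 2)) * cos (t - s / 2) + (2 * cos (s / 2))\<^sup>2 - \<alpha>\<bar>"
    by (simp only: norm_of_real)
  then show ?thesis
    by (simp add: norm_mult norm_power u_def y_def x)
qed

lemma AE_circ_cos_neq: "AE s in circ. 1 + cos s > 0"
proof -
  have "1 + cos s > 0" if "cis s \<noteq> -1" for s
  proof -
    have "cos s \<noteq> -1"
    proof
      assume c: "cos s = -1"
      then have "sin s = 0" using sin_cos_squared_add[of s] by simp
      with c that show False by (simp add: complex_eq_iff)
    qed
    then show ?thesis using cos_ge_minus_one[of s] by linarith
  qed
  then show ?thesis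
    using AE_circ_cis_neq[of "-1"] by (auto elim: eventually_mono)
qed

text \<open>Here \<open>2 * (1 + cos s)\<close> is the squared modulus of \<open>1 + cis s\<close>,
  so the mean is the Mahler measure of \<open>(1 + x)\<^sup>2\<close>, which is 0. This removes the
  leading coefficient of \<open>P_poly\<close> in \<open>y\<close>, provides an integrable majorant
  near s = \<pi>, and is the limit in the asymptotics of \<open>S_integral\<close>.\<close>

lemma ln_one_plus_cos:
  "integrable circ (\<lambda>s. ln (2 * (1 + cos s)))" "integral\<^sup>L circ (\<lambda>s. ln (2 * (1 + cos s))) = 0"
proof -
  have "\<bar>2 * c + 2\<bar> = 2 * (1 + c)" if "- 1 \<le> c" for c :: real
    using that by simp
  from this[OF cos_ge_minus_one] have "\<bar>2 * cos (t - 0) + 2\<bar> = 2 * (1 + cos t)" for t :: real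
    by simp
  then show "integrable circ (\<lambda>s. ln (2 * (1 + cos s)))" "integral\<^sup>L circ (\<lambda>s. ln (2 * (1 + cos s))) = 0"
    using jensen_cos(2,3)[of 0 2] by (simp_all add: arcosh_max_le_1)
qed

lemma mahler_S_poly:
  "mahler_measure (S_poly \<alpha>)
     = 1 / (2 * pi) * (\<integral>s. arcosh_max (2 * (cos s)\<^sup>2 - 1 + \<alpha> * (1 + cos s)) \<partial>circ)"
proof (rule mahler_measure_iterated[where C = "ln (4 + 4 * \<bar>\<alpha>\<bar>)"])
  have "(\<lambda>z. S_poly \<alpha> (cis (fst z)) (cis (snd z))) \<in> borel_measurable (borel \<Otimes>\<^sub>M borel)"
    unfolding S_poly_def by measurable
  then show "(\<lambda>z. S_poly \<alpha> (cis (fst z)) (cis (snd z))) \<in> borel_measurable borel"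
    by (simp add: borel_prod)
  show "ln (cmod (S_poly \<alpha> (cis s) (cis t))) \<le> ln (4 + 4 * \<bar>\<alpha>\<bar>)" for s t
  \<comment> \<open>At a zero the left-hand side is \<open>ln 0 = 0\<close>, and the right-hand side
    is nonnegative.\<close>
  proof (cases "cmod (S_poly \<alpha> (cis s) (cis t)) = 0")
    case False
    have "\<bar>\<alpha> * (1 + cos s)\<bar> \<le> \<bar>\<alpha>\<bar> * 2"
      unfolding abs_mult by (intro mult_left_mono) (use abs_cos_le_one[of s] in linarith, simp)
    then have "cmod (S_poly \<alpha> (cis s) (cis t)) \<le> 4 + 4 * \<bar>\<alpha>\<bar>"
      unfolding S_poly_cmod using abs_cos_le_one[of "t - 2 * s"] abs_cos_le_one[of "2 * s"]
      by linarith
    with False show ?thesis by (intro ln_mono) auto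
  qed auto
  show "AE s in circ. integrable circ (\<lambda>t. ln (cmod (S_poly \<alpha> (cis s) (cis t)))) \<and>
          integral\<^sup>L circ (\<lambda>t. ln (cmod (S_poly \<alpha> (cis s) (cis t)))) =
          2 * pi * arcosh_max (2 * (cos s)\<^sup>2 - 1 + \<alpha> * (1 + cos s))"
  proof -
    have "(2 * cos (2 * s) + 2 * \<alpha> * (1 + cos s)) / 2 = 2 * (cos s)\<^sup>2 - 1 + \<alpha> * (1 + cos s)" for s
      by (subst cos_double_cos) (simp add: field_simps)
    then show ?thesis
      unfolding S_poly_cmod by (intro AE_I2 conjI jensen_cos(2)) (simp only: jensen_cos(3))
  qed
  show "integrable circ (\<lambda>s. arcosh_max (2 * (cos s)\<^sup>2 - 1 + \<alpha> * (1 + cos s)))"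
    by (intro circ_continuous continuous_on_compose2[OF arcosh_max_continuous[of UNIV]] continuous_intros) auto
qed simp

text \<open>The argument blows up at s = \<pi>, but only like \<open>1 / r\<close> with
  \<open>r = sqrt (2 * (1 + cos s))\<close>. Since arcosh grows logarithmically, a constant minus
  \<open>ln r\<close> dominates, and \<open>ln r\<close> is half of the integrable function
  \<open>ln (2 * (1 + cos s))\<close>.\<close>

lemma integrable_arcosh_P:
  "integrable circ (\<lambda>s. arcosh_max ((2 * (1 + cos s) - \<alpha>) / (2 * sqrt (2 * (1 + cos s)))))"
proof (rule Bochner_Integration.integrable_bound)
  show "integrable circ (\<lambda>s. ln (8 + 2 * \<bar>\<alpha>\<bar>) - ln (2 * (1 + cos s)) / 2)"
    by (intro Bochner_Integration.integrable_diff integrable_divide ln_one_plus_cos) auto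
  show "(\<lambda>s. arcosh_max ((2 * (1 + cos s) - \<alpha>) / (2 * sqrt (2 * (1 + cos s))))) \<in> borel_measurable circ"
    by (intro measurable_restrict_space1) measurable
  show "AE s in circ. norm (arcosh_max ((2 * (1 + cos s) - \<alpha>) / (2 * sqrt (2 * (1 + cos s)))))
          \<le> norm (ln (8 + 2 * \<bar>\<alpha>\<bar>) - ln (2 * (1 + cos s)) / 2)"
    using AE_circ_cos_neq
  proof eventually_elim
    case (elim s)
    define r where "r = sqrt (2 * (1 + cos s))"
    have r0: "r > 0" using elim by (simp add: r_def)
    have r2: "2 * (1 + cos s) = r\<^sup>2" using elim by (simp add: r_def)
    have "r\<^sup>2 \<le> 2\<^sup>2" using cos_le_one[of s] by (simp flip: r2)
    then have r_le: "r \<le> 2" by (rule power2_le_imp_le) simp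
    have "max 1 \<bar>(r\<^sup>2 - \<alpha>) / (2 * r)\<bar> \<le> (4 + \<bar>\<alpha>\<bar>) / r"
    proof (rule max.boundedI)
      have "\<bar>r\<^sup>2 - \<alpha>\<bar> \<le> 4 + \<bar>\<alpha>\<bar>" using \<open>r\<^sup>2 \<le> 2\<^sup>2\<close> r0 by (simp add: abs_le_iff) (smt (verit) zero_le_power2)
      then have "\<bar>r\<^sup>2 - \<alpha>\<bar> \<le> 2 * (4 + \<bar>\<alpha>\<bar>)" by (rule order_trans) simp
      then show "\<bar>(r\<^sup>2 - \<alpha>) / (2 * r)\<bar> \<le> (4 + \<bar>\<alpha>\<bar>) / r"
        using r0 by (simp add: abs_mult field_simps)
    qed (use r0 r_le in \<open>simp add: field_simps\<close>)
    then have "ln (2 * max 1 \<bar>(r\<^sup>2 - \<alpha>) / (2 * r)\<bar>) \<le> ln (2 * ((4 + \<bar>\<alpha>\<bar>) / r))"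
      by (intro ln_mono mult_left_mono) auto
    also have "2 * ((4 + \<bar>\<alpha>\<bar>) / r) = (8 + 2 * \<bar>\<alpha>\<bar>) / r"
      by simp
    also have "ln ((8 + 2 * \<bar>\<alpha>\<bar>) / r) = ln (8 + 2 * \<bar>\<alpha>\<bar>) - ln r"
      by (rule ln_divide_pos) (use r0 in \<open>simp_all add: add_pos_nonneg\<close>)
    also have "ln r = ln (r\<^sup>2) / 2" using r0 by (simp add: ln_realpow)
    finally have "arcosh_max ((r\<^sup>2 - \<alpha>) / (2 * r)) \<le> ln (8 + 2 * \<bar>\<alpha>\<bar>) - ln (r\<^sup>2) / 2"
      using arcosh_max_le_ln[of "(r\<^sup>2 - \<alpha>) / (2 * r)"] by linarith
    then show ?case
      using arcosh_max_nonneg[of "(r\<^sup>2 - \<alpha>) / (2 * r)"] unfolding r2 r_def[symmetric]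
      unfolding r_def[symmetric] r2[symmetric] by simp
  qed
qed

text \<open>As a quadratic in \<open>y\<close>, the polynomial has leading coefficient of modulus
  \<open>\<bar>c\<bar>\<close> with \<open>c = 2 * cos (s / 2)\<close>. Jensen's formula therefore
  yields the extra term \<open>ln \<bar>c\<bar>\<close>, which is half of
  \<open>ln (2 * (1 + cos s))\<close> and has mean 0.\<close>

lemma mahler_P_poly:
  "mahler_measure (P_poly \<alpha>)
     = 1 / (2 * pi) * (\<integral>s. arcosh_max ((2 * (1 + cos s) - \<alpha>) / (2 * sqrt (2 * (1 + cos s)))) \<partial>circ)"
proof -
  let ?A = "\<lambda>s. arcosh_max ((2 * (1 + cos s) - \<alpha>) / (2 * sqrt (2 * (1 + cos s))))"
  have "mahler_measure (P_poly \<alpha>) = 1 / (2 * pi) * (\<integral>s. ln (2 * (1 + cos s)) / 2 + ?A s \<partial>circ)"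
  proof (rule mahler_measure_iterated[where C = "ln (8 + \<bar>\<alpha>\<bar>)"])
    have "(\<lambda>z. P_poly \<alpha> (cis (fst z)) (cis (snd z))) \<in> borel_measurable (borel \<Otimes>\<^sub>M borel)"
      unfolding P_poly_def by measurable
    then show "(\<lambda>z. P_poly \<alpha> (cis (fst z)) (cis (snd z))) \<in> borel_measurable borel"
      by (simp add: borel_prod)
    show "ln (cmod (P_poly \<alpha> (cis s) (cis t))) \<le> ln (8 + \<bar>\<alpha>\<bar>)" for s t
    proof (cases "cmod (P_poly \<alpha> (cis s) (cis t)) = 0")
      case False
      have "cmod (P_poly \<alpha> (cis s) (cis t)) \<le> cmod ((cis s + 1) * (cis t + 1) * (cis s + cis t)) + cmod (of_real \<alpha> * cis s * cis t)"
        unfolding P_poly_def by (rule norm_triangle_ineq4)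
      also have "cmod (of_real \<alpha> * cis s * cis t) = \<bar>\<alpha>\<bar>"
        by (simp add: norm_mult)
      also have "cmod ((cis s + 1) * (cis t + 1) * (cis s + cis t)) \<le> 2 * 2 * 2"
        unfolding norm_mult
        by (intro mult_mono mult_nonneg_nonneg norm_ge_zero norm_triangle_le) auto
      finally have "cmod (P_poly \<alpha> (cis s) (cis t)) \<le> 8 + \<bar>\<alpha>\<bar>" by simp
      with False show ?thesis by (intro ln_mono) auto
    qed auto
    show "AE s in circ. integrable circ (\<lambda>t. ln (cmod (P_poly \<alpha> (cis s) (cis t)))) \<and>
            integral\<^sup>L circ (\<lambda>t. ln (cmod (P_poly \<alpha> (cis s) (cis t)))) =
            2 * pi * (ln (2 * (1 + cos s)) / 2 + ?A s)"
      using AE_circ_cos_neq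
    proof eventually_elim
      case (elim s)
      define c where "c = 2 * cos (s / 2)"
      have c2: "c\<^sup>2 = 2 * (1 + cos s)"
        using cos_double_cos[of "s / 2"] by (simp add: c_def power_mult_distrib)
      then have c0: "c \<noteq> 0" using elim by auto
      have sc: "sqrt (2 * (1 + cos s)) = \<bar>c\<bar>" unfolding c2[symmetric] by simp
      define B where "B = c - \<alpha> / c"
      have prod: "\<bar>2 * c * cos (t - s / 2) + c\<^sup>2 - \<alpha>\<bar> = \<bar>c\<bar> * \<bar>2 * cos (t - s / 2) + B\<bar>" for t
      proof -
        have "2 * c * k + c\<^sup>2 - \<alpha> = c * (2 * k + B)" for k
          using c0 by (simp add: B_def field_simps power2_eq_square)
        then show ?thesis by (simp only: abs_mult)
      qed
      have ae: "AE t in circ. ln \<bar>c\<bar> + ln \<bar>2 * cos (t - s / 2) + B\<bar> = ln (cmod (P_poly \<alpha> (cis s) (cis t)))"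
        using jensen_cos(1)[of "s / 2" B]
        by eventually_elim (use c0 in \<open>simp add: P_poly_cmod prod ln_mult flip: c_def\<close>)
      have meas: "(\<lambda>t. ln (cmod (P_poly \<alpha> (cis s) (cis t)))) \<in> borel_measurable circ"
        unfolding P_poly_def by (intro measurable_restrict_space1) measurable
      have int: "integrable circ (\<lambda>t. ln \<bar>c\<bar> + ln \<bar>2 * cos (t - s / 2) + B\<bar>)"
        by (intro Bochner_Integration.integrable_add jensen_cos) auto
      have "integrable circ (\<lambda>t. ln (cmod (P_poly \<alpha> (cis s) (cis t))))"
        by (rule integrable_cong_AE_imp[OF int meas]) (use ae in eventually_elim, simp)
      moreover have "integral\<^sup>L circ (\<lambda>t. ln (cmod (P_poly \<alpha> (cis s) (cis t)))) =
            2 * pi * (ln (2 * (1 + cos s)) / 2 + ?A s)"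
      proof -
        have "integral\<^sup>L circ (\<lambda>t. ln (cmod (P_poly \<alpha> (cis s) (cis t))))
            = integral\<^sup>L circ (\<lambda>t. ln \<bar>c\<bar> + ln \<bar>2 * cos (t - s / 2) + B\<bar>)"
          by (rule integral_cong_AE[symmetric]) (use meas int ae in \<open>auto dest: borel_measurable_integrable\<close>)
        also have "\<dots> = 2 * pi * ln \<bar>c\<bar> + 2 * pi * arcosh_max (B / 2)"
          using measure_circ
          by (subst Bochner_Integration.integral_add) (auto simp: jensen_cos)
        also have "arcosh_max (B / 2) = ?A s"
        proof -
          \<comment> \<open>For s > \<pi> the number \<open>c\<close> is negative while the square
            root is positive; the comparison is between absolute values because
            \<open>arcosh_max\<close> is even.\<close>
          have "\<bar>B / 2\<bar> = \<bar>(2 * (1 + cos s) - \<alpha>) / (2 * sqrt (2 * (1 + cos s)))\<bar>"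
            unfolding sc unfolding c2[symmetric] B_def using c0
            by (simp add: abs_mult power2_eq_square diff_divide_eq_iff)
          then show ?thesis by (simp only: arcosh_max_def)
        qed
        also have "ln \<bar>c\<bar> = ln (2 * (1 + cos s)) / 2"
          using c0 ln_realpow[of "\<bar>c\<bar>" 2] unfolding c2[symmetric] by simp
        finally show ?thesis by (simp add: algebra_simps)
      qed
      ultimately show ?case ..
    qed
    show "integrable circ (\<lambda>s. ln (2 * (1 + cos s)) / 2 + ?A s)"
      by (intro Bochner_Integration.integrable_add integrable_arcosh_P integrable_divide ln_one_plus_cos)
  qed auto
  also have "(\<integral>s. ln (2 * (1 + cos s)) / 2 + ?A s \<partial>circ) = (\<integral>s. ?A s \<partial>circ)"
    by (subst Bochner_Integration.integral_add[OF integrable_divide[OF ln_one_plus_cos(1)] integrable_arcosh_P])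
       (simp only: integral_divide_zero ln_one_plus_cos(2) div_0 add_0_left)
  finally show ?thesis .
qed

subsection \<open>Integration in the parameter\<close>

text \<open>Dropping the absolute value turns the integrands, for a suitable sign, into
  \<open>arcosh (max 1 h)\<close> with \<open>h\<close> affine and increasing in the parameter. This
  gives derivatives of constant sign, as needed for Tonelli's theorem.\<close>

lemma arcosh_max_eq: "x \<ge> -1 \<Longrightarrow> arcosh_max x = arcosh (max 1 x)"
  unfolding arcosh_max_def by (rule arg_cong[of _ _ arcosh]) (simp add: max_def abs_if)

text \<open>This is the derivative in \<open>x\<close> of \<open>arcosh (max 1 (u * x + v))\<close>
  for \<open>u > 0\<close>, with value 0 also at the corner \<open>u * x + v = 1\<close>, where the
  right-hand slope is infinite.\<close>

definition arcosh_kernel :: "real \<Rightarrow> real \<Rightarrow> real \<Rightarrow> real" where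
  "arcosh_kernel u v x = (if u * x + v > 1 then u / sqrt ((u * x + v)\<^sup>2 - 1) else 0)"

lemma measurable_arcosh_kernel [measurable (raw)]:
  assumes [measurable]: "u \<in> borel_measurable M" "v \<in> borel_measurable M" "x \<in> borel_measurable M"
  shows "(\<lambda>z. arcosh_kernel (u z) (v z) (x z)) \<in> borel_measurable M"
  unfolding arcosh_kernel_def by measurable

lemma arcosh_kernel_nonneg: "u \<ge> 0 \<Longrightarrow> arcosh_kernel u v x \<ge> 0"
  by (simp add: arcosh_kernel_def)

lemma arcosh_max_1_mono: "x \<le> y \<Longrightarrow> arcosh (max 1 x) \<le> arcosh (max 1 (y :: real))"
proof (cases "max 1 x = max 1 y")
  case False
  assume "x \<le> y"
  then have "max 1 x \<le> max 1 y" by (intro max.mono) auto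
  with False have "max 1 x < max 1 y" unfolding less_le by blast
  from arcosh_real_strict_mono[OF max.cobounded1 this] show ?thesis
    by (rule less_imp_le)
qed simp

lemma nn_integral_arcosh_kernel:
  assumes "u > 0" "a \<le> b"
  shows "(\<integral>\<^sup>+ x\<in>{a<..<b}. ennreal (arcosh_kernel u v x) \<partial>lborel)
    = ennreal (arcosh (max 1 (u * b + v)) - arcosh (max 1 (u * a + v)))"
proof -
  have "(arcosh_kernel u v has_integral arcosh (max 1 (u * b + v)) - arcosh (max 1 (u * a + v))) {a..b}"
  \<comment> \<open>The excluded point is the corner \<open>u * x + v = 1\<close>. The
    antiderivative is continuous there, so the inverse square root singularity of the kernel is
    integrable.\<close>
  proof (rule fundamental_theorem_of_calculus_interior_strong[of "{(1 - v) / u}"])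
    fix x assume x: "x \<in> {a<..<b} - {(1 - v) / u}"
    show "((\<lambda>x. arcosh (max 1 (u * x + v))) has_vector_derivative arcosh_kernel u v x) (at x)"
    proof (cases "u * x + v > 1")
      case True
      have "((\<lambda>x. arcosh (u * x + v)) has_real_derivative 1 / sqrt ((u * x + v)\<^sup>2 - 1) * u) (at x)"
        using True by (intro DERIV_chain2[OF arcosh_real_has_field_derivative]) (auto intro!: derivative_eq_intros)
      then have "((\<lambda>x. arcosh (u * x + v)) has_real_derivative arcosh_kernel u v x) (at x)"
        using True by (simp add: arcosh_kernel_def)
      then show ?thesis
        unfolding has_real_derivative_iff_has_vector_derivative
      proof (rule has_vector_derivative_transform_within_open[of _ _ _ "{x. u * x + v > 1}"])
        show "open {x. 1 < u * x + v}"
          by (intro open_Collect_less continuous_intros)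
      qed (use True in auto)
    next
      case False
      with x \<open>u > 0\<close> have *: "u * x + v < 1"
        by (auto simp: field_simps)
      have "((\<lambda>x. arcosh 1) has_real_derivative arcosh_kernel u v x) (at x)"
        using False by (auto simp: arcosh_kernel_def)
      then show ?thesis
        unfolding has_real_derivative_iff_has_vector_derivative
      proof (rule has_vector_derivative_transform_within_open[of _ _ _ "{x. u * x + v < 1}"])
        show "open {x. u * x + v < 1}"
          by (intro open_Collect_less continuous_intros)
      qed (use * in auto)
    qed
  next
    show "continuous_on {a..b} (\<lambda>x. arcosh (max 1 (u * x + v)))"
      by (intro continuous_intros) auto
  qed (use assms in auto)
  then have "(arcosh_kernel u v has_integral arcosh (max 1 (u * b + v)) - arcosh (max 1 (u * a + v))) {a<..<b}"
    by (simp add: has_integral_Icc_iff_Ioo)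
  then have "((\<lambda>x. arcosh_kernel u v x * indicator {a<..<b} x) has_integral
      arcosh (max 1 (u * b + v)) - arcosh (max 1 (u * a + v))) UNIV"
    by (subst (asm) has_integral_restrict_UNIV[symmetric])
       (auto elim!: has_integral_eq[rotated] simp: indicator_def)
  then have "(\<integral>\<^sup>+ x. ennreal (arcosh_kernel u v x * indicator {a<..<b} x) \<partial>lborel)
      = ennreal (arcosh (max 1 (u * b + v)) - arcosh (max 1 (u * a + v)))"
    using assms
    by (intro nn_integral_has_integral_lborel) (auto intro!: mult_nonneg_nonneg arcosh_kernel_nonneg)
  then show ?thesis
    by (simp add: ennreal_mult'' ennreal_indicator)
qed

text \<open>For each \<open>s\<close> the increment is the integral of a nonnegative kernel, and
  Tonelli's theorem exchanges it with the mean over \<open>s\<close>. The inequality is kept as a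
  separate conclusion because \<open>ennreal\<close> sends negative numbers to 0: without it, an
  identity of extended nonnegative reals would not determine the real difference.\<close>

lemma integral_arcosh_affine_diff:
  assumes [measurable]: "u \<in> borel_measurable borel" "v \<in> borel_measurable borel"
    and pos: "AE s in circ. u s > 0" and ab: "a \<le> b"
    and int: "integrable circ (\<lambda>s. arcosh (max 1 (u s * a + v s)))"
             "integrable circ (\<lambda>s. arcosh (max 1 (u s * b + v s)))"
  shows "ennreal ((\<integral>s. arcosh (max 1 (u s * b + v s)) \<partial>circ) - (\<integral>s. arcosh (max 1 (u s * a + v s)) \<partial>circ))
     = (\<integral>\<^sup>+ x\<in>{a<..<b}. (\<integral>\<^sup>+ s. ennreal (arcosh_kernel (u s) (v s) x) \<partial>circ) \<partial>lborel)" (is ?th1)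
   and "(\<integral>s. arcosh (max 1 (u s * a + v s)) \<partial>circ) \<le> (\<integral>s. arcosh (max 1 (u s * b + v s)) \<partial>circ)" (is ?th2)
proof -
  interpret P: pair_sigma_finite circ lborel ..
  let ?A = "\<lambda>x s. arcosh (max 1 (u s * x + v s))"
  have mono: "AE s in circ. ?A a s \<le> ?A b s"
    using pos by eventually_elim (intro arcosh_max_1_mono, use ab in simp)
  show ?th2
    by (rule integral_mono_AE[OF int mono])
  have "ennreal ((\<integral>s. ?A b s \<partial>circ) - (\<integral>s. ?A a s \<partial>circ)) = ennreal (\<integral>s. ?A b s - ?A a s \<partial>circ)"
    by (subst Bochner_Integration.integral_diff[OF int(2,1)]) simp
  also have "\<dots> = (\<integral>\<^sup>+ s. ennreal (?A b s - ?A a s) \<partial>circ)"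
    using mono by (intro nn_integral_eq_integral[symmetric] Bochner_Integration.integrable_diff int) auto
  also have "\<dots> = (\<integral>\<^sup>+ s. (\<integral>\<^sup>+ x. ennreal (arcosh_kernel (u s) (v s) x) * indicator {a<..<b} x \<partial>lborel) \<partial>circ)"
    by (rule nn_integral_cong_AE)
       (use pos in eventually_elim, simp add: nn_integral_arcosh_kernel ab)
  also have "\<dots> = (\<integral>\<^sup>+ x. (\<integral>\<^sup>+ s. ennreal (arcosh_kernel (u s) (v s) x) * indicator {a<..<b} x \<partial>circ) \<partial>lborel)"
  proof (rule P.Fubini'[symmetric])
    have [measurable]: "u \<in> borel_measurable circ" "v \<in> borel_measurable circ"
      by (intro measurable_restrict_space1; simp)+
    show "(\<lambda>(s, x). ennreal (arcosh_kernel (u s) (v s) x) * indicator {a<..<b} x) \<in> borel_measurable (circ \<Otimes>\<^sub>M lborel)"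
      by measurable
  qed
  also have "\<dots> = (\<integral>\<^sup>+ x\<in>{a<..<b}. (\<integral>\<^sup>+ s. ennreal (arcosh_kernel (u s) (v s) x) \<partial>circ) \<partial>lborel)"
    by (intro nn_integral_cong) (auto simp: indicator_def)
  finally show ?th1 .
qed

text \<open>Under \<open>q = 1 + cos s\<close> one has \<open>(sin s)\<^sup>2 = q * (2 - q)\<close>.
  The two half circles are each mapped onto the whole interval, with opposite orientations, which
  gives the factor 2.\<close>

lemma nn_integral_circ_cos:
  fixes f :: "real \<Rightarrow> real"
  assumes [measurable]: "f \<in> borel_measurable borel"
    and nonneg: "\<And>q. q \<in> {0<..<2} \<Longrightarrow> f q \<ge> 0"
  shows "(\<integral>\<^sup>+ s. ennreal (f (1 + cos s)) \<partial>circ) = 2 * (\<integral>\<^sup>+ q\<in>{0<..<2}. ennreal (f q / sqrt (q * (2 - q))) \<partial>lborel)"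
proof -
  let ?F = "\<lambda>q. f q / sqrt (q * (2 - q))"
  have sin: "\<bar>sin s\<bar> * ?F (1 + cos s) = f (1 + cos s)" if "sin s \<noteq> 0" for s
  proof -
    have "(1 + cos s) * (2 - (1 + cos s)) = (sin s)\<^sup>2"
      by (simp add: sin_squared_eq algebra_simps power2_eq_square)
    then show ?thesis using that by simp
  qed
  have sin_neg: "sin s < 0" if "s \<in> {pi<..<2 * pi}" for s
    using sin_lt_zero that by auto
  have 1: "(\<integral>\<^sup>+ s\<in>{0<..<pi}. ennreal (f (1 + cos s)) \<partial>lborel) = (\<integral>\<^sup>+ q\<in>{0<..<2}. ennreal (?F q) \<partial>lborel)"
  proof -
    have "(\<integral>\<^sup>+ s\<in>{0<..<pi}. ennreal (f (1 + cos s)) \<partial>lborel)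
        = (\<integral>\<^sup>+ s\<in>{0<..<pi}. ennreal (sin s * ?F (1 + cos s)) \<partial>lborel)"
    proof (intro nn_integral_cong)
      fix s
      show "ennreal (f (1 + cos s)) * indicator {0<..<pi} s = ennreal (sin s * ?F (1 + cos s)) * indicator {0<..<pi} s"
        using sin[of s] sin_gt_zero[of s] by (auto simp: indicator_def)
    qed
    also have "\<dots> = (\<integral>\<^sup>+ q\<in>{1 + cos pi<..<1 + cos 0}. ennreal (?F q) \<partial>lborel)"
      by (rule nn_integral_change_of_variables_decreasing)
         (auto intro!: continuous_intros derivative_eq_intros sin_gt_zero nonneg divide_nonneg_nonneg)
    finally show ?thesis by simp
  qed
  have 2: "(\<integral>\<^sup>+ s\<in>{pi<..<2 * pi}. ennreal (f (1 + cos s)) \<partial>lborel) = (\<integral>\<^sup>+ q\<in>{0<..<2}. ennreal (?F q) \<partial>lborel)"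
  proof -
    have "(\<integral>\<^sup>+ s\<in>{pi<..<2 * pi}. ennreal (f (1 + cos s)) \<partial>lborel)
        = (\<integral>\<^sup>+ s\<in>{pi<..<2 * pi}. ennreal (- sin s * ?F (1 + cos s)) \<partial>lborel)"
    proof (intro nn_integral_cong)
      fix s
      show "ennreal (f (1 + cos s)) * indicator {pi<..<2 * pi} s = ennreal (- sin s * ?F (1 + cos s)) * indicator {pi<..<2 * pi} s"
        using sin[of s] sin_neg[of s] by (auto simp: indicator_def)
    qed
    also have "\<dots> = (\<integral>\<^sup>+ q\<in>{1 + cos pi<..<1 + cos (2 * pi)}. ennreal (?F q) \<partial>lborel)"
      by (rule nn_integral_change_of_variables_increasing)
         (auto intro!: continuous_intros derivative_eq_intros sin_neg nonneg divide_nonneg_nonneg)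
    finally show ?thesis by simp
  qed
  have "(\<integral>\<^sup>+ s. ennreal (f (1 + cos s)) \<partial>circ) = (\<integral>\<^sup>+ s\<in>{0..2 * pi}. ennreal (f (1 + cos s)) \<partial>lborel)"
    by (simp add: nn_integral_restrict_space)
  also have "\<dots> = (\<integral>\<^sup>+ s. ennreal (f (1 + cos s)) * indicator {0<..<pi} s
        + ennreal (f (1 + cos s)) * indicator {pi<..<2 * pi} s \<partial>lborel)"
  proof (rule nn_integral_cong_AE)
    have "AE s in lborel. s \<notin> {0, pi, 2 * pi}"
      by (intro AE_not_in countable_imp_null_set_lborel) auto
    then show "AE s in lborel. ennreal (f (1 + cos s)) * indicator {0..2 * pi} s
        = ennreal (f (1 + cos s)) * indicator {0<..<pi} s + ennreal (f (1 + cos s)) * indicator {pi<..<2 * pi} s"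
      by eventually_elim (auto simp: indicator_def)
  qed
  also have "\<dots> = (\<integral>\<^sup>+ s\<in>{0<..<pi}. ennreal (f (1 + cos s)) \<partial>lborel) + (\<integral>\<^sup>+ s\<in>{pi<..<2 * pi}. ennreal (f (1 + cos s)) \<partial>lborel)"
    by (intro nn_integral_add) measurable
  finally show ?thesis
    by (simp only: 1 2 mult_2[symmetric])
qed

subsection \<open>The map of degree two and the periods\<close>

text \<open>
  Throughout, \<open>a = - \<alpha>\<close>. With \<open>D = (2 - q)((a + 4)/2 - q)\<close> and \<open>N = (a + 4)/2 q - q\<^sup>2 - 1\<close> the period of
  \<open>S\<^sub>\<alpha>\<close> has the integrand \<open>1/(2 sqrt (DN))\<close>. The map below is \<open>2D/(D + N)\<close>: it takes the roots of \<open>D\<close> to \<open>0\<close>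
  and those of \<open>N\<close> to \<open>2\<close>, two of the four branch points of the curve of \<open>P\<^sub>\<alpha>\<close>, and the other two are
  its critical values.
\<close>

definition quad_map :: "real \<Rightarrow> real \<Rightarrow> real" where
  "quad_map a q = (2 - q) * (a + 4 - 2 * q) / (a + 3 - 2 * q)"

definition quad_map_deriv :: "real \<Rightarrow> real \<Rightarrow> real" where
  "quad_map_deriv a q = (1 - a - (a + 3 - 2 * q)\<^sup>2) / (a + 3 - 2 * q)\<^sup>2"

definition P_density :: "real \<Rightarrow> real \<Rightarrow> real" where
  "P_density a p = 1 / sqrt (p * (2 - p) * ((a + 2 * p)\<^sup>2 - 8 * p))"

definition S_radicand :: "real \<Rightarrow> real \<Rightarrow> real" where
  "S_radicand a q = (2 - q) * ((a + 4) / 2 - q) * ((a + 4) / 2 * q - q\<^sup>2 - 1)"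

lemma measurable_quad_map [measurable]:
  "quad_map a \<in> borel_measurable borel" "quad_map_deriv a \<in> borel_measurable borel"
  "P_density a \<in> borel_measurable borel"
  unfolding quad_map_def[abs_def] quad_map_deriv_def[abs_def] P_density_def[abs_def] by measurable

lemma continuous_on_quad_map:
  "(\<And>q. q \<in> A \<Longrightarrow> a + 3 - 2 * q \<noteq> 0) \<Longrightarrow> continuous_on A (quad_map a)"
  unfolding quad_map_def[abs_def] by (intro continuous_intros) auto

lemma has_field_derivative_quad_map:
  assumes "a + 3 - 2 * q \<noteq> 0"
  shows "(quad_map a has_field_derivative quad_map_deriv a q) (at q)"
proof -
  define M where "M = a + 3 - 2 * q"
  have M: "M \<noteq> 0" using assms by (simp add: M_def)
  have q: "q = (a + 3 - M) / 2" by (simp add: M_def)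
  have "(quad_map a has_field_derivative
      ((- (a + 4 - 2 * q) - 2 * (2 - q)) * (a + 3 - 2 * q) - (2 - q) * (a + 4 - 2 * q) * (- 2))
         / ((a + 3 - 2 * q) * (a + 3 - 2 * q))) (at q)"
    unfolding quad_map_def[abs_def] using assms
    by (auto intro!: derivative_eq_intros)
  moreover have "((- (a + 4 - 2 * q) - 2 * (2 - q)) * (a + 3 - 2 * q) - (2 - q) * (a + 4 - 2 * q) * (- 2))
         / ((a + 3 - 2 * q) * (a + 3 - 2 * q)) = quad_map_deriv a q"
    unfolding quad_map_deriv_def using assms
    by (simp add: divide_simps) (simp add: algebra_simps power2_eq_square)
  ultimately show ?thesis by simp
qed

text \<open>This is the pullback of the holomorphic differential under the 2-isogeny. With
  \<open>M = a + 3 - 2 * q\<close>, the equation for \<open>p\<close> reads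
  \<open>M\<^sup>2 + (2 - a - 2 * p) * M + (1 - a) = 0\<close>. Its discriminant
  \<open>(a + 2 * p)\<^sup>2 - 8 * p\<close> is the square of the difference
  \<open>M - (1 - a) / M\<close> of its roots, and this difference is, up to sign,
  \<open>M * quad_map_deriv a q\<close>. Since \<open>p * (2 - p)\<close> is
  \<open>4 * S_radicand a q / M\<^sup>2\<close>, the Jacobian cancels and leaves the factor
  1/2.\<close>

lemma P_density_quad_map:
  assumes M: "a + 3 - 2 * q \<noteq> 0" and W: "quad_map_deriv a q \<noteq> 0" and S: "S_radicand a q > 0"
  shows "\<bar>quad_map_deriv a q\<bar> * P_density a (quad_map a q) = 1 / (2 * sqrt (S_radicand a q))"
proof -
  define p where "p = quad_map a q"
  define M where "M = a + 3 - 2 * q"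
  have M0: "M \<noteq> 0" using M by (simp add: M_def)
  have p: "p = (2 - q) * (M + 1) / M"
    by (simp add: p_def quad_map_def M_def)
  have p2: "2 - p = ((a + 4) * q - 2 * q\<^sup>2 - 2) / M"
    unfolding p using M0 by (simp add: divide_simps) (simp add: M_def algebra_simps power2_eq_square)
  have d: "(a + 2 * p)\<^sup>2 - 8 * p = (M * quad_map_deriv a q)\<^sup>2"
  proof -
    have "M * quad_map_deriv a q = (1 - a - M\<^sup>2) / M"
      using M0 unfolding quad_map_deriv_def M_def[symmetric] by (simp add: power2_eq_square)
    moreover define K where "K = (2 - q) * (M + 1)"
    have "(a + 2 * p)\<^sup>2 - 8 * p = ((a * M + 2 * K)\<^sup>2 - 8 * K * M) / M\<^sup>2"
      unfolding p K_def[symmetric] using M0 by (simp add: field_simps power2_eq_square)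
    moreover have "(a * M + 2 * K)\<^sup>2 - 8 * K * M = (1 - a - M\<^sup>2)\<^sup>2"
      unfolding K_def M_def by algebra
    ultimately show ?thesis
      by (simp add: power_divide)
  qed
  have pp: "p * (2 - p) = 4 * S_radicand a q / M\<^sup>2"
  proof -
    define E where "E = (a + 4) / 2 - q"
    define N where "N = (a + 4) / 2 * q - q\<^sup>2 - 1"
    have "M + 1 = 2 * E" "(a + 4) * q - 2 * q\<^sup>2 - 2 = 2 * N"
      by (simp_all add: M_def E_def N_def field_simps)
    then have "p * (2 - p) = ((2 - q) * (2 * E) / M) * (2 * N / M)"
      by (simp only: p2) (simp only: p)
    then show ?thesis
      unfolding S_radicand_def E_def[symmetric] N_def[symmetric] by (simp add: power2_eq_square)
  qed
  have "p * (2 - p) * ((a + 2 * p)\<^sup>2 - 8 * p) = (2 * quad_map_deriv a q)\<^sup>2 * S_radicand a q"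
    unfolding d pp using M0 by (simp add: power_mult_distrib)
  then have "sqrt (p * (2 - p) * ((a + 2 * p)\<^sup>2 - 8 * p)) = 2 * \<bar>quad_map_deriv a q\<bar> * sqrt (S_radicand a q)"
    by (simp add: real_sqrt_mult abs_mult)
  then show ?thesis
    unfolding P_density_def p_def[symmetric] using W S by simp
qed

section \<open>Comparison of the period integrands on (0, 2)\<close>

lemma arcosh_kernel_divide:
  assumes "c > 0"
  shows "arcosh_kernel (1 / c) (y / c) x = (if x + y > c then 1 / sqrt ((x + y)\<^sup>2 - c\<^sup>2) else 0)"
proof -
  have e: "1 / c * x + y / c = (x + y) / c"
    by (simp add: add_divide_distrib)
  have "((x + y) / c)\<^sup>2 - 1 = ((x + y)\<^sup>2 - c\<^sup>2) / c\<^sup>2"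
    using assms by (simp add: power_divide diff_divide_distrib)
  then have "sqrt (((x + y) / c)\<^sup>2 - 1) = sqrt ((x + y)\<^sup>2 - c\<^sup>2) / c"
    using assms by (simp add: real_sqrt_divide)
  moreover have "(x + y) / c > 1 \<longleftrightarrow> x + y > c"
    using assms by simp
  ultimately show ?thesis
    unfolding arcosh_kernel_def e using assms by simp
qed

text \<open>With \<open>N\<close> as below, \<open>h - 1 = 2 * N\<close> and
  \<open>h + 1 = 2 * q * ((a + 4) / 2 - q)\<close>. One factor \<open>q\<close> of
  \<open>h\<^sup>2 - 1\<close> combines with the weight \<open>q * (2 - q)\<close> to the square
  \<open>q\<^sup>2\<close>, which cancels the slope \<open>q\<close> in the numerator and leaves the
  quartic \<open>S_radicand\<close>.\<close>

lemma S_kernel_neg: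
  assumes q: "q \<in> {0<..<2}" and a: "a > 1"
  shows "arcosh_kernel q (1 - 2 * (q - 1)\<^sup>2) a / sqrt (q * (2 - q))
    = (if (a + 4) / 2 * q - q\<^sup>2 - 1 > 0 then 1 / (2 * sqrt (S_radicand a q)) else 0)"
proof -
  define N where "N = (a + 4) / 2 * q - q\<^sup>2 - 1"
  define h where "h = q * a + (1 - 2 * (q - 1)\<^sup>2)"
  have h: "h = 1 + 2 * N" by (simp add: h_def N_def field_simps power2_eq_square)
  show ?thesis
  proof (cases "N > 0")
    case True
    have "(h\<^sup>2 - 1) * (q * (2 - q)) = (2 * q)\<^sup>2 * S_radicand a q"
      unfolding S_radicand_def N_def[symmetric] unfolding h
      unfolding N_def by (simp add: field_simps power2_eq_square)
    then have "sqrt (h\<^sup>2 - 1) * sqrt (q * (2 - q)) = 2 * q * sqrt (S_radicand a q)"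
      using q by (simp flip: real_sqrt_mult) (simp add: real_sqrt_mult)
    then show ?thesis
      using True q unfolding arcosh_kernel_def h_def[symmetric] N_def[symmetric]
      by (simp add: h)
  next
    case False
    then show ?thesis
      unfolding arcosh_kernel_def h_def[symmetric] N_def[symmetric] by (simp add: h)
  qed
qed

text \<open>The argument is minus the one for \<open>a = - \<alpha>\<close>, so
  \<open>h\<^sup>2 - 1\<close> and the quartic are formally the same; only the region
  \<open>h > 1\<close> changes. It is now governed by
  \<open>h - 1 = 2 * q * (q - (2 - \<alpha> / 2))\<close>, that is, by a root of \<open>D\<close>
  instead of a root of \<open>N\<close>.\<close>

lemma S_kernel_pos:
  assumes q: "q \<in> {0<..<2}"
  shows "arcosh_kernel q (2 * (q - 1)\<^sup>2 - 1) \<alpha> / sqrt (q * (2 - q))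
    = (if q > 2 - \<alpha> / 2 then 1 / (2 * sqrt (S_radicand (- \<alpha>) q)) else 0)"
proof -
  define h where "h = q * \<alpha> + (2 * (q - 1)\<^sup>2 - 1)"
  have h: "h = 1 + 2 * q * (q - (2 - \<alpha> / 2))" by (simp add: h_def field_simps power2_eq_square)
  show ?thesis
  proof (cases "q > 2 - \<alpha> / 2")
    case True
    then have h1: "h > 1" using q by (simp add: h)
    have "(h\<^sup>2 - 1) * (q * (2 - q)) = (2 * q)\<^sup>2 * S_radicand (- \<alpha>) q"
      unfolding S_radicand_def h_def by (simp add: field_simps power2_eq_square)
    then have "sqrt (h\<^sup>2 - 1) * sqrt (q * (2 - q)) = 2 * q * sqrt (S_radicand (- \<alpha>) q)"
      using q by (simp flip: real_sqrt_mult) (simp add: real_sqrt_mult)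
    then show ?thesis
      using True h1 q unfolding arcosh_kernel_def h_def[symmetric] by simp
  next
    case False
    then have "h \<le> 1" using q by (simp add: h mult_le_0_iff)
    with False show ?thesis
      unfolding arcosh_kernel_def h_def[symmetric] by simp
  qed
qed

text \<open>The variable \<open>q\<close> runs from a root \<open>r\<close> of \<open>N\<close> to
  the root 2 of \<open>D\<close>. The map sends these ends to 2 and 0, and it is decreasing since
  the numerator \<open>1 - a - (a + 3 - 2 * q)\<^sup>2\<close> of its derivative is negative for
  \<open>a > 1\<close>. The image is all of (0, 2), where the kernel of the cubic family never
  vanishes.\<close>

lemma nn_integral_kernel_neg:
  assumes a: "a > 1"
  shows "(\<integral>\<^sup>+ q\<in>{0<..<2}. ennreal (arcosh_kernel q (1 - 2 * (q - 1)\<^sup>2) a / sqrt (q * (2 - q))) \<partial>lborel)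
    = (\<integral>\<^sup>+ p\<in>{0<..<2}. ennreal (arcosh_kernel (1 / (2 * sqrt (2 * p))) (2 * p / (2 * sqrt (2 * p))) a
          / sqrt (p * (2 - p))) \<partial>lborel)"
proof -
  define A where "A = (a + 4) / 2"
  define d where "d = sqrt (A\<^sup>2 - 4)"
  \<comment> \<open>These are the roots of \<open>N\<close>, with sum \<open>A\<close> and product
    1. At \<open>q = 2\<close> the value of \<open>N\<close> is \<open>a - 1 > 0\<close>, so 2 lies
    strictly between them and \<open>N\<close> is positive exactly for \<open>q > r\<close> within
    (0, 2).\<close>
  define r where "r = (A - d) / 2"
  define r' where "r' = (A + d) / 2"
  have A: "A > 5 / 2" using a by (simp add: A_def)
  have "(3 / 2)\<^sup>2 < A\<^sup>2 - 4"
  proof -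
    have "(5 / 2)\<^sup>2 < A\<^sup>2" using A by (intro power_strict_mono) auto
    then show ?thesis by (simp add: power2_eq_square)
  qed
  then have d: "d > 3 / 2"
    unfolding d_def by (rule real_less_rsqrt)
  have dd: "d * d = A * A - 4"
    using \<open>(3 / 2)\<^sup>2 < A\<^sup>2 - 4\<close> unfolding d_def by (simp add: power2_eq_square)
  have rr': "r * r' = 1"
    using dd by (simp add: r_def r'_def field_simps)
  have r': "r' > 2" using A d by (simp add: r'_def)
  have r0: "r > 0" using rr' r' by (metis zero_less_mult_pos2 zero_less_one less_trans zero_less_numeral)
  have "r * 2 < r * r'" using r' r0 by (rule mult_strict_left_mono)
  then have r2: "r < 2" using rr' by simp
  have N: "(a + 4) / 2 * q - q\<^sup>2 - 1 = (q - r) * (r' - q)" for q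
  proof -
    have "(q - r) * (r' - q) = (r + r') * q - q\<^sup>2 - r * r'"
      by (simp add: algebra_simps power2_eq_square)
    moreover have "r + r' = A"
      by (simp add: r_def r'_def field_simps)
    ultimately show ?thesis unfolding rr' by (simp add: A_def)
  qed
  have M: "a + 3 - 2 * q > 0" if "q \<le> 2" for q using that a by simp
  have W: "- quad_map_deriv a q > 0" if "q \<le> 2" for q
  proof -
    have "1 - a - (a + 3 - 2 * q)\<^sup>2 < 0"
      using a zero_le_power2[of "a + 3 - 2 * q"] by linarith
    then have "quad_map_deriv a q < 0"
      unfolding quad_map_deriv_def using M[OF that] by (intro divide_neg_pos) auto
    then show ?thesis by simp
  qed
  have end1: "quad_map a 2 = 0" by (simp add: quad_map_def)
  have end2: "quad_map a r = 2"
    using N[of r] M[of r] r2 by (simp add: quad_map_def field_simps power2_eq_square)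
  \<comment> \<open>Completing the square in \<open>p\<close> leaves the remainder
    \<open>4 * (a - 1)\<close>: for \<open>a > 1\<close> the two remaining branch points are not
    real.\<close>
  have disc: "(a + 2 * p)\<^sup>2 - 8 * p > 0" for p
  proof -
    have "(a + 2 * p)\<^sup>2 - 8 * p = (2 * p + a - 2)\<^sup>2 + 4 * (a - 1)"
      by (simp add: algebra_simps power2_eq_square)
    with a show ?thesis by (simp add: add_nonneg_pos)
  qed
  have "(\<integral>\<^sup>+ q\<in>{0<..<2}. ennreal (arcosh_kernel q (1 - 2 * (q - 1)\<^sup>2) a / sqrt (q * (2 - q))) \<partial>lborel)
      = (\<integral>\<^sup>+ q\<in>{r<..<2}. ennreal (- quad_map_deriv a q * P_density a (quad_map a q)) \<partial>lborel)"
  proof (intro nn_integral_cong)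
    fix q
    show "ennreal (arcosh_kernel q (1 - 2 * (q - 1)\<^sup>2) a / sqrt (q * (2 - q))) * indicator {0<..<2} q
        = ennreal (- quad_map_deriv a q * P_density a (quad_map a q)) * indicator {r<..<2} q"
    proof (cases "q \<in> {0<..<2}")
      case True
      then have "r' - q > 0" using r' by simp
      then have iff: "(q - r) * (r' - q) > 0 \<longleftrightarrow> r < q"
        by (simp add: zero_less_mult_iff)
      show ?thesis
      proof (cases "r < q")
        case rq: True
        have "S_radicand a q > 0"
        proof -
          have "(2 - q) * ((a + 4) / 2 - q) > 0"
            using True a by (intro mult_pos_pos) auto
          then show ?thesis
            unfolding S_radicand_def N using iff rq by (rule_tac mult_pos_pos) auto
        qed
        then have "- quad_map_deriv a q * P_density a (quad_map a q) = 1 / (2 * sqrt (S_radicand a q))"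
          using P_density_quad_map[of a q] M[of q] W[of q] True by (simp add: abs_of_neg)
        then show ?thesis
          using rq True unfolding S_kernel_neg[OF True a] N iff by simp
      next
        case False
        then show ?thesis
          unfolding S_kernel_neg[OF True a] N iff by simp
      qed
    qed (use r0 in auto)
  qed
  also have "\<dots> = (\<integral>\<^sup>+ p\<in>{quad_map a 2<..<quad_map a r}. ennreal (P_density a p) \<partial>lborel)"
  proof (rule nn_integral_change_of_variables_decreasing[OF r2])
    show "continuous_on {r..2} (quad_map a)"
      using M by (intro continuous_on_quad_map) force
    show "(quad_map a has_field_derivative - (- quad_map_deriv a x)) (at x)" if "x \<in> {r<..<2}" for x
      using has_field_derivative_quad_map[of a x] M[of x] that by auto
    show "P_density a p \<ge> 0" if "p \<in> {quad_map a 2<..<quad_map a r}" for p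
      using that disc[of p] unfolding end1 end2 P_density_def by simp
  qed (use W in auto)
  also have "\<dots> = (\<integral>\<^sup>+ p\<in>{0<..<2}. ennreal (arcosh_kernel (1 / (2 * sqrt (2 * p))) (2 * p / (2 * sqrt (2 * p))) a
          / sqrt (p * (2 - p))) \<partial>lborel)"
    unfolding end1 end2
  proof (intro nn_integral_cong)
    fix p
    show "ennreal (P_density a p) * indicator {0<..<2} p =
      ennreal (arcosh_kernel (1 / (2 * sqrt (2 * p))) (2 * p / (2 * sqrt (2 * p))) a / sqrt (p * (2 - p))) * indicator {0<..<2} p"
    proof (cases "p \<in> {0<..<2}")
      case True
      have c: "(2 * sqrt (2 * p))\<^sup>2 = 8 * p" using True by simp
      have "a + 2 * p > 2 * sqrt (2 * p)"
        by (rule power2_less_imp_less) (use c disc[of p] True a in auto)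
      moreover have "2 * sqrt (2 * p) > 0" using True by simp
      ultimately show ?thesis
        using True unfolding arcosh_kernel_divide[OF \<open>2 * sqrt (2 * p) > 0\<close>] c P_density_def
        by (auto simp: real_sqrt_mult mult_ac)
    qed auto
  qed
  finally show ?thesis .
qed

text \<open>Here \<open>q\<close> runs between the two roots 2 - \<alpha>/2 and 2 of
  \<open>D\<close>, both of which are sent to 0. The map rises to its critical value
  \<open>p0\<close> and falls back, so each half of the interval covers (0, \<open>p0\<close>) once,
  and (0, \<open>p0\<close>) is exactly where the kernel of the cubic family is nonzero.\<close>

lemma nn_integral_kernel_pos:
  assumes \<alpha>: "0 < \<alpha>" "\<alpha> < 4"
  shows "(\<integral>\<^sup>+ q\<in>{0<..<2}. ennreal (arcosh_kernel q (2 * (q - 1)\<^sup>2 - 1) \<alpha> / sqrt (q * (2 - q))) \<partial>lborel)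
    = 2 * (\<integral>\<^sup>+ p\<in>{0<..<2}. ennreal (arcosh_kernel (1 / (2 * sqrt (2 * p))) (- 2 * p / (2 * sqrt (2 * p))) \<alpha>
          / sqrt (p * (2 - p))) \<partial>lborel)"
proof -
  define s where "s = sqrt (1 + \<alpha>)"
  define A where "A = 2 - \<alpha> / 2"
  \<comment> \<open>the critical point of \<open>quad_map (- \<alpha>)\<close> in \<open>(A, 2)\<close>, where the interval is folded\<close>
  define c where "c = (4 - s\<^sup>2 + s) / 2"
  \<comment> \<open>The critical value: at the fold \<open>M = - s\<close>, and the map takes the
    value \<open>(M + 1 + \<alpha>) * (M + 1) / (2 * M)\<close> with 1 + \<alpha> equal to
    \<open>s\<^sup>2\<close>.\<close>
  define p0 where "p0 = (s - 1)\<^sup>2 / 2"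
  have s2: "s\<^sup>2 = 1 + \<alpha>" using \<alpha> by (simp add: s_def)
  have s1: "s > 1" using \<alpha> by (simp add: s_def)
  have s3: "s < 3" using \<alpha> by (auto simp: s_def intro: real_less_lsqrt)
  have ss: "s < s\<^sup>2" using s1 by (simp add: power2_eq_square)
  have \<alpha>s: "\<alpha> = s\<^sup>2 - 1" by (simp add: s2)
  have Ac: "A < c" and c2: "c < 2" and A0: "A > 0"
    using s1 ss \<alpha> by (simp_all add: A_def c_def s2)
  define M where "M q = - \<alpha> + 3 - 2 * q" for q
  have M: "M q < 0" if "A \<le> q" for q
    using that by (simp add: M_def A_def)
  have Mc: "M c = - s" by (simp add: M_def c_def s2 field_simps)
  have W: "quad_map_deriv (- \<alpha>) q = (s\<^sup>2 - (M q)\<^sup>2) / (M q)\<^sup>2" for q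
    unfolding quad_map_deriv_def M_def s2 by simp
  have W1: "quad_map_deriv (- \<alpha>) q > 0" if "A < q" "q < c" for q
  proof -
    have "- M q < s" using that Mc by (simp add: M_def)
    then have "(- M q)\<^sup>2 < s\<^sup>2" using M[of q] that by (intro power_strict_mono) auto
    then show ?thesis using M[of q] that by (simp add: W)
  qed
  have W2: "- quad_map_deriv (- \<alpha>) q > 0" if "c < q" for q
  proof -
    have "- M q > s" using that Mc by (simp add: M_def)
    then have "(- M q)\<^sup>2 > s\<^sup>2" using s1 by (intro power_strict_mono) auto
    then show ?thesis using M[of q] that Ac by (simp add: W divide_less_0_iff)
  qed
  have end1: "quad_map (- \<alpha>) 2 = 0" "quad_map (- \<alpha>) A = 0"
    by (simp_all add: quad_map_def A_def)
  have end2: "quad_map (- \<alpha>) c = p0"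
  proof -
    have "quad_map (- \<alpha>) c = (2 - c) * (M c + 1) / M c"
      by (simp add: quad_map_def M_def)
    also have "\<dots> = p0"
      unfolding Mc using s1 by (simp add: c_def p0_def field_simps power2_eq_square)
    finally show ?thesis .
  qed
  have sq_less_iff: "x\<^sup>2 < y\<^sup>2 \<longleftrightarrow> x < y" if "x \<ge> 0" "y \<ge> 0" for x y :: real
    using that by (metis linorder_not_less pos2 power_mono_iff)
  \<comment> \<open>With \<open>t = sqrt (2 * p)\<close> the inequality is quadratic in
    \<open>t\<close>; completing the square gives \<open>(t + 1)\<^sup>2 < 1 + \<alpha>\<close>.
    Thus the cutoff of the kernel is the critical value of the map.\<close>
  have iff: "2 * sqrt (2 * p) < \<alpha> + - 2 * p \<longleftrightarrow> p < p0" if "p > 0" for p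
  proof -
    define t where "t = sqrt (2 * p)"
    have t: "2 * p = t\<^sup>2" "t > 0" using that by (simp_all add: t_def)
    have "2 * t < \<alpha> + - 2 * p \<longleftrightarrow> (t + 1)\<^sup>2 < s\<^sup>2"
      using t unfolding \<alpha>s by (simp add: power2_eq_square algebra_simps)
    also have "\<dots> \<longleftrightarrow> t < s - 1"
      using t s1 by (subst sq_less_iff) auto
    also have "\<dots> \<longleftrightarrow> t\<^sup>2 < (s - 1)\<^sup>2"
      using t s1 by (subst sq_less_iff) auto
    also have "\<dots> \<longleftrightarrow> p < p0"
      unfolding t(1)[symmetric] by (auto simp: p0_def)
    finally show ?thesis by (simp add: t_def)
  qed
  have p0: "p0 < 2"
  proof -
    have "(s - 1)\<^sup>2 < 2\<^sup>2" using s1 s3 by (intro power_strict_mono) auto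
    then show ?thesis by (simp add: p0_def)
  qed
  have disc: "(- \<alpha> + 2 * p)\<^sup>2 - 8 * p > 0" if "0 < p" "p < p0" for p
  proof -
    have "(2 * sqrt (2 * p))\<^sup>2 < (\<alpha> + - 2 * p)\<^sup>2"
      using iff[of p] that by (intro power_strict_mono) auto
    then show ?thesis using that by (simp add: power2_eq_square algebra_simps)
  qed
  let ?I = "\<integral>\<^sup>+ p\<in>{0<..<p0}. ennreal (P_density (- \<alpha>) p) \<partial>lborel"
  \<comment> \<open>Since 0 < \<open>A\<close> < 2, the quadratic
    \<open>q\<^sup>2 - A * q + 1\<close> has no real root. Beyond \<open>A\<close> two factors of
    \<open>S_radicand\<close> are negative, so the product is positive.\<close>
  have S_pos: "S_radicand (- \<alpha>) q > 0" if "A < q" "q < 2" for q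
  proof -
    have "(q - A / 2)\<^sup>2 + (1 - (A / 2)\<^sup>2) > 0"
    proof (rule add_nonneg_pos)
      have "(A / 2)\<^sup>2 < 1" using A0 \<alpha> by (simp add: abs_square_less_1 A_def)
      then show "1 - (A / 2)\<^sup>2 > 0" by simp
    qed simp
    then have "- (A * q - q\<^sup>2 - 1) > 0"
      by (simp add: power2_eq_square algebra_simps)
    then have pos: "(2 - q) * (q - A) * - (A * q - q\<^sup>2 - 1) > 0"
      using that by (intro mult_pos_pos) auto
    have A_eq: "(- \<alpha> + 4) / 2 = A" by (simp add: A_def field_simps)
    have eq: "(2 - q) * (q - A) * - (A * q - q\<^sup>2 - 1) = (2 - q) * (A - q) * (A * q - q\<^sup>2 - 1)"
      by algebra
    show ?thesis
      using pos unfolding eq S_radicand_def A_eq .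
  qed
  have dens: "\<bar>quad_map_deriv (- \<alpha>) q\<bar> * P_density (- \<alpha>) (quad_map (- \<alpha>) q) = 1 / (2 * sqrt (S_radicand (- \<alpha>) q))"
    if "A < q" "q < 2" "q \<noteq> c" for q
  proof (rule P_density_quad_map)
    have "q < c \<or> c < q" using that by linarith
    then show "quad_map_deriv (- \<alpha>) q \<noteq> 0"
      using W1[of q] W2[of q] that by auto
    show "- \<alpha> + 3 - 2 * q \<noteq> 0"
      using M[of q] that by (simp add: M_def)
    show "S_radicand (- \<alpha>) q > 0"
      using S_pos that by simp
  qed
  have nonneg: "P_density (- \<alpha>) p \<ge> 0" if "0 < p" "p < p0" for p
    using that disc[of p] p0 unfolding P_density_def by simp
  have cont: "continuous_on {u..v} (quad_map (- \<alpha>))" if "A \<le> u" for u v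
    using M that by (intro continuous_on_quad_map) (force simp: M_def)
  have der: "(quad_map (- \<alpha>) has_field_derivative quad_map_deriv (- \<alpha>) q) (at q)" if "A \<le> q" for q
    using M[of q] that by (intro has_field_derivative_quad_map) (auto simp: M_def)
  have 1: "(\<integral>\<^sup>+ q\<in>{A<..<c}. ennreal (1 / (2 * sqrt (S_radicand (- \<alpha>) q))) \<partial>lborel) = ?I"
  proof -
    have "(\<integral>\<^sup>+ q\<in>{A<..<c}. ennreal (1 / (2 * sqrt (S_radicand (- \<alpha>) q))) \<partial>lborel)
        = (\<integral>\<^sup>+ q\<in>{A<..<c}. ennreal (quad_map_deriv (- \<alpha>) q * P_density (- \<alpha>) (quad_map (- \<alpha>) q)) \<partial>lborel)"
    proof (intro nn_integral_cong)
      fix q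
      show "ennreal (1 / (2 * sqrt (S_radicand (- \<alpha>) q))) * indicator {A<..<c} q
          = ennreal (quad_map_deriv (- \<alpha>) q * P_density (- \<alpha>) (quad_map (- \<alpha>) q)) * indicator {A<..<c} q"
        using dens[of q] W1[of q] c2 by (cases "q \<in> {A<..<c}") auto
    qed
    also have "\<dots> = (\<integral>\<^sup>+ p\<in>{quad_map (- \<alpha>) A<..<quad_map (- \<alpha>) c}. ennreal (P_density (- \<alpha>) p) \<partial>lborel)"
      by (rule nn_integral_change_of_variables_increasing[OF Ac])
         (use W1 nonneg in \<open>auto intro!: cont der simp: end1 end2\<close>)
    finally show ?thesis by (simp add: end1 end2)
  qed
  have 2: "(\<integral>\<^sup>+ q\<in>{c<..<2}. ennreal (1 / (2 * sqrt (S_radicand (- \<alpha>) q))) \<partial>lborel) = ?I"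
  proof -
    have "(\<integral>\<^sup>+ q\<in>{c<..<2}. ennreal (1 / (2 * sqrt (S_radicand (- \<alpha>) q))) \<partial>lborel)
        = (\<integral>\<^sup>+ q\<in>{c<..<2}. ennreal (- quad_map_deriv (- \<alpha>) q * P_density (- \<alpha>) (quad_map (- \<alpha>) q)) \<partial>lborel)"
    proof (intro nn_integral_cong)
      fix q
      show "ennreal (1 / (2 * sqrt (S_radicand (- \<alpha>) q))) * indicator {c<..<2} q
          = ennreal (- quad_map_deriv (- \<alpha>) q * P_density (- \<alpha>) (quad_map (- \<alpha>) q)) * indicator {c<..<2} q"
        using dens[of q] W2[of q] Ac by (cases "q \<in> {c<..<2}") (auto simp: abs_of_neg)
    qed
    also have "\<dots> = (\<integral>\<^sup>+ p\<in>{quad_map (- \<alpha>) 2<..<quad_map (- \<alpha>) c}. ennreal (P_density (- \<alpha>) p) \<partial>lborel)"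
      by (rule nn_integral_change_of_variables_decreasing[OF c2])
         (use W2 nonneg Ac in \<open>auto intro!: cont der simp: end1 end2\<close>)
    finally show ?thesis by (simp add: end1 end2)
  qed
  have [measurable]: "S_radicand (- \<alpha>) \<in> borel_measurable borel"
    unfolding S_radicand_def[abs_def] by measurable
  have "(\<integral>\<^sup>+ q\<in>{0<..<2}. ennreal (arcosh_kernel q (2 * (q - 1)\<^sup>2 - 1) \<alpha> / sqrt (q * (2 - q))) \<partial>lborel)
      = (\<integral>\<^sup>+ q. ennreal (1 / (2 * sqrt (S_radicand (- \<alpha>) q))) * indicator {A<..<c} q
           + ennreal (1 / (2 * sqrt (S_radicand (- \<alpha>) q))) * indicator {c<..<2} q \<partial>lborel)"
  proof (rule nn_integral_cong_AE)
    have "AE q in lborel. q \<notin> {c}"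
      by (intro AE_not_in countable_imp_null_set_lborel) auto
    then show "AE q in lborel. ennreal (arcosh_kernel q (2 * (q - 1)\<^sup>2 - 1) \<alpha> / sqrt (q * (2 - q))) * indicator {0<..<2} q
        = ennreal (1 / (2 * sqrt (S_radicand (- \<alpha>) q))) * indicator {A<..<c} q
           + ennreal (1 / (2 * sqrt (S_radicand (- \<alpha>) q))) * indicator {c<..<2} q"
    proof eventually_elim
      case (elim q)
      show ?case
      proof (cases "q \<in> {0<..<2}")
        case True
        then show ?thesis
          using elim Ac c2 unfolding S_kernel_pos[OF True] A_def[symmetric]
          by (auto simp: indicator_def)
      qed (use A0 Ac c2 in \<open>auto simp: indicator_def\<close>)
    qed
  qed
  also have "\<dots> = ?I + ?I"
    by (subst nn_integral_add) (simp_all only: 1 2, measurable)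
  also have "?I = (\<integral>\<^sup>+ p\<in>{0<..<2}. ennreal (arcosh_kernel (1 / (2 * sqrt (2 * p))) (- 2 * p / (2 * sqrt (2 * p))) \<alpha>
          / sqrt (p * (2 - p))) \<partial>lborel)"
  proof (intro nn_integral_cong)
    fix p
    show "ennreal (P_density (- \<alpha>) p) * indicator {0<..<p0} p =
      ennreal (arcosh_kernel (1 / (2 * sqrt (2 * p))) (- 2 * p / (2 * sqrt (2 * p))) \<alpha> / sqrt (p * (2 - p))) * indicator {0<..<2} p"
    proof (cases "p \<in> {0<..<2}")
      case True
      have c: "(2 * sqrt (2 * p))\<^sup>2 = 8 * p" using True by simp
      have c0: "2 * sqrt (2 * p) > 0" using True by simp
      have sq: "(\<alpha> + - 2 * p)\<^sup>2 = (- \<alpha> + 2 * p)\<^sup>2" by (simp add: power2_eq_square algebra_simps)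
      have "p > 0" using True by simp
      show ?thesis
        unfolding arcosh_kernel_divide[OF c0] iff[OF \<open>p > 0\<close>] c sq P_density_def
        using True p0 by (auto simp: real_sqrt_mult mult_ac indicator_def)
    qed (use p0 in auto)
  qed
  finally show ?thesis by (simp only: mult_2)
qed

subsection \<open>Comparison of the two Mahler measures\<close>

definition S_integral :: "real \<Rightarrow> real" where
  "S_integral \<alpha> = (\<integral>s. arcosh_max (2 * (cos s)\<^sup>2 - 1 + \<alpha> * (1 + cos s)) \<partial>circ)"

definition P_integral :: "real \<Rightarrow> real" where
  "P_integral \<alpha> = (\<integral>s. arcosh_max ((2 * (1 + cos s) - \<alpha>) / (2 * sqrt (2 * (1 + cos s)))) \<partial>circ)"

section \<open>The integrands as increasing functions of the parameter\<close>

lemma integrable_arcosh_S: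
  "integrable circ (\<lambda>s. arcosh_max (2 * (cos s)\<^sup>2 - 1 + \<alpha> * (1 + cos s)))"
  by (intro circ_continuous continuous_on_compose2[OF arcosh_max_continuous[of UNIV]] continuous_intros) auto

lemma one_plus_cos_nonneg: "0 \<le> 1 + cos (s :: real)"
proof -
  have "0 \<le> 1 + c" if "-1 \<le> c" for c :: real using that by simp
  then show ?thesis using cos_ge_minus_one .
qed

lemma cos_sq_le_one: "(cos (s :: real))\<^sup>2 \<le> 1"
  by (simp add: abs_square_le_1)

lemma S_integrand_neg:
  assumes "a \<ge> 0"
  shows "arcosh_max (2 * (cos s)\<^sup>2 - 1 + (- a) * (1 + cos s))
    = arcosh (max 1 ((1 + cos s) * a + (1 - 2 * (cos s)\<^sup>2)))"
proof -
  have "(1 + cos s) * a + (1 - 2 * (cos s)\<^sup>2) \<ge> -1"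
    using mult_nonneg_nonneg[OF one_plus_cos_nonneg[of s] assms] cos_sq_le_one[of s] by linarith
  moreover have "2 * (cos s)\<^sup>2 - 1 + (- a) * (1 + cos s) = - ((1 + cos s) * a + (1 - 2 * (cos s)\<^sup>2))"
    by (simp add: algebra_simps)
  ultimately show ?thesis
    by (simp only: arcosh_max_minus arcosh_max_eq)
qed

lemma S_integrand_pos:
  assumes "a \<ge> 0"
  shows "arcosh_max (2 * (cos s)\<^sup>2 - 1 + a * (1 + cos s))
    = arcosh (max 1 ((1 + cos s) * a + (2 * (cos s)\<^sup>2 - 1)))"
proof -
  have "(1 + cos s) * a + (2 * (cos s)\<^sup>2 - 1) \<ge> -1"
    using mult_nonneg_nonneg[OF one_plus_cos_nonneg[of s] assms] zero_le_power2[of "cos s"] by linarith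
  moreover have "2 * (cos s)\<^sup>2 - 1 + a * (1 + cos s) = (1 + cos s) * a + (2 * (cos s)\<^sup>2 - 1)"
    by (simp add: algebra_simps)
  ultimately show ?thesis
    by (simp only: arcosh_max_eq)
qed

lemma P_integrand_neg:
  assumes "a \<ge> 0"
  shows "arcosh_max ((2 * (1 + cos s) - (- a)) / (2 * sqrt (2 * (1 + cos s))))
    = arcosh (max 1 (1 / (2 * sqrt (2 * (1 + cos s))) * a + 2 * (1 + cos s) / (2 * sqrt (2 * (1 + cos s)))))"
proof -
  define p where "p = 1 + cos s"
  have p: "p \<ge> 0" unfolding p_def by (rule one_plus_cos_nonneg)
  have "(2 * p - (- a)) / (2 * sqrt (2 * p)) \<ge> 0"
    using p assms by (intro divide_nonneg_nonneg) auto
  then have "(2 * p - (- a)) / (2 * sqrt (2 * p)) \<ge> -1"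
    by linarith
  moreover have "(2 * p - (- a)) / (2 * sqrt (2 * p)) = 1 / (2 * sqrt (2 * p)) * a + 2 * p / (2 * sqrt (2 * p))"
    by (simp add: add_divide_distrib)
  ultimately show ?thesis
    unfolding p_def[symmetric] by (simp only: arcosh_max_eq)
qed

lemma P_integrand_pos:
  assumes "a \<ge> 0"
  shows "arcosh_max ((2 * (1 + cos s) - a) / (2 * sqrt (2 * (1 + cos s))))
    = arcosh (max 1 (1 / (2 * sqrt (2 * (1 + cos s))) * a + - 2 * (1 + cos s) / (2 * sqrt (2 * (1 + cos s)))))"
proof -
  define p where "p = 1 + cos s"
  have p: "p \<ge> 0" unfolding p_def by (rule one_plus_cos_nonneg)
  have p2: "p \<le> 2" unfolding p_def using cos_le_one[of s] by linarith
  \<comment> \<open>This includes \<open>p = 0\<close>, where the quotient is 0 by the convention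
    for division by 0.\<close>
  have "- 2 * p / (2 * sqrt (2 * p)) = - (sqrt (2 * p) / 2)"
    using real_div_sqrt[of "2 * p"] p by (simp add: field_simps)
  moreover have "sqrt (2 * p) \<le> 2"
    using p2 real_sqrt_le_mono[of "2 * p" 4] by simp
  ultimately have "- 2 * p / (2 * sqrt (2 * p)) \<ge> -1" by linarith
  moreover have "1 / (2 * sqrt (2 * p)) * a \<ge> 0"
    using p assms by simp
  ultimately have "1 / (2 * sqrt (2 * p)) * a + - 2 * p / (2 * sqrt (2 * p)) \<ge> -1"
    by linarith
  moreover have "(2 * p - a) / (2 * sqrt (2 * p)) = - (1 / (2 * sqrt (2 * p)) * a + - 2 * p / (2 * sqrt (2 * p)))"
    by (simp add: diff_divide_distrib)
  ultimately show ?thesis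
    unfolding p_def[symmetric] by (simp only: arcosh_max_minus arcosh_max_eq)
qed

lemma AE_circ_weight_pos: "AE s in circ. 0 < 1 / (2 * sqrt (2 * (1 + cos s)))"
  using AE_circ_cos_neq by eventually_elim simp

definition S_period_pos where
  "S_period_pos x = (\<integral>\<^sup>+ s. ennreal (arcosh_kernel (1 + cos s) (2 * (cos s)\<^sup>2 - 1) x) \<partial>circ)"
definition S_period_neg where
  "S_period_neg x = (\<integral>\<^sup>+ s. ennreal (arcosh_kernel (1 + cos s) (1 - 2 * (cos s)\<^sup>2) x) \<partial>circ)"
text \<open>The factor \<open>e\<close> encodes the sign of the parameter: \<open>e = 2\<close>
  belongs to \<alpha> = -x and \<open>e = - 2\<close> to \<alpha> = x, the argument being (x + 2p)
  or (x - 2p) over the same denominator. Extended nonnegative values avoid any finiteness question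
  for a single \<open>x\<close>.\<close>

definition P_period where
  "P_period e x = (\<integral>\<^sup>+ s. ennreal (arcosh_kernel (1 / (2 * sqrt (2 * (1 + cos s))))
     (e * (1 + cos s) / (2 * sqrt (2 * (1 + cos s)))) x) \<partial>circ)"

section \<open>Differences of the means as integrals of periods\<close>

lemma S_integral_diff_pos:
  assumes "0 \<le> a" "a \<le> b"
  shows "ennreal (S_integral b - S_integral a) = (\<integral>\<^sup>+ x\<in>{a<..<b}. S_period_pos x \<partial>lborel)"
proof -
  have e: "S_integral x = (\<integral>s. arcosh (max 1 ((1 + cos s) * x + (2 * (cos s)\<^sup>2 - 1))) \<partial>circ)" if "x \<ge> 0" for x
    unfolding S_integral_def by (simp only: S_integrand_pos[OF that])
  have i: "integrable circ (\<lambda>s. arcosh (max 1 ((1 + cos s) * x + (2 * (cos s)\<^sup>2 - 1))))" if "x \<ge> 0" for x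
    using integrable_arcosh_S[of x] by (simp only: S_integrand_pos[OF that])
  have b: "b \<ge> 0" using assms by simp
  show ?thesis
    unfolding e[OF assms(1)] e[OF b] S_period_pos_def
    by (rule integral_arcosh_affine_diff(1)[OF _ _ AE_circ_cos_neq assms(2) i[OF assms(1)] i[OF b]]) measurable
qed

lemma S_integral_diff_neg:
  assumes "0 \<le> a" "a \<le> b"
  shows "ennreal (S_integral (- b) - S_integral (- a)) = (\<integral>\<^sup>+ x\<in>{a<..<b}. S_period_neg x \<partial>lborel)"
    and "S_integral (- a) \<le> S_integral (- b)"
proof -
  have e: "S_integral (- x) = (\<integral>s. arcosh (max 1 ((1 + cos s) * x + (1 - 2 * (cos s)\<^sup>2))) \<partial>circ)" if "x \<ge> 0" for x
    unfolding S_integral_def by (simp only: S_integrand_neg[OF that])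
  have i: "integrable circ (\<lambda>s. arcosh (max 1 ((1 + cos s) * x + (1 - 2 * (cos s)\<^sup>2))))" if "x \<ge> 0" for x
    using integrable_arcosh_S[of "- x"] by (simp only: S_integrand_neg[OF that])
  have b: "b \<ge> 0" using assms by simp
  note d = integral_arcosh_affine_diff[OF _ _ AE_circ_cos_neq assms(2) i[OF assms(1)] i[OF b]]
  show "ennreal (S_integral (- b) - S_integral (- a)) = (\<integral>\<^sup>+ x\<in>{a<..<b}. S_period_neg x \<partial>lborel)"
    unfolding e[OF assms(1)] e[OF b] S_period_neg_def by (rule d(1)) measurable
  show "S_integral (- a) \<le> S_integral (- b)"
    unfolding e[OF assms(1)] e[OF b] by (rule d(2)) measurable
qed

lemma P_integral_diff_pos:
  assumes "0 \<le> a" "a \<le> b"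
  shows "ennreal (P_integral b - P_integral a) = (\<integral>\<^sup>+ x\<in>{a<..<b}. P_period (- 2) x \<partial>lborel)"
    and "P_integral a \<le> P_integral b"
proof -
  have e: "P_integral x = (\<integral>s. arcosh (max 1 (1 / (2 * sqrt (2 * (1 + cos s))) * x
      + - 2 * (1 + cos s) / (2 * sqrt (2 * (1 + cos s))))) \<partial>circ)" if "x \<ge> 0" for x
    unfolding P_integral_def by (simp only: P_integrand_pos[OF that])
  have i: "integrable circ (\<lambda>s. arcosh (max 1 (1 / (2 * sqrt (2 * (1 + cos s))) * x
      + - 2 * (1 + cos s) / (2 * sqrt (2 * (1 + cos s))))))" if "x \<ge> 0" for x
    using integrable_arcosh_P[of x] by (simp only: P_integrand_pos[OF that])
  have b: "b \<ge> 0" using assms by simp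
  note d = integral_arcosh_affine_diff[OF _ _ AE_circ_weight_pos assms(2) i[OF assms(1)] i[OF b]]
  show "ennreal (P_integral b - P_integral a) = (\<integral>\<^sup>+ x\<in>{a<..<b}. P_period (- 2) x \<partial>lborel)"
    unfolding e[OF assms(1)] e[OF b] P_period_def by (rule d(1)) measurable
  show "P_integral a \<le> P_integral b"
    unfolding e[OF assms(1)] e[OF b] by (rule d(2)) measurable
qed

lemma P_integral_diff_neg:
  assumes "0 \<le> a" "a \<le> b"
  shows "ennreal (P_integral (- b) - P_integral (- a)) = (\<integral>\<^sup>+ x\<in>{a<..<b}. P_period 2 x \<partial>lborel)"
    and "P_integral (- a) \<le> P_integral (- b)"
proof -
  have e: "P_integral (- x) = (\<integral>s. arcosh (max 1 (1 / (2 * sqrt (2 * (1 + cos s))) * x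
      + 2 * (1 + cos s) / (2 * sqrt (2 * (1 + cos s))))) \<partial>circ)" if "x \<ge> 0" for x
    unfolding P_integral_def by (simp only: P_integrand_neg[OF that])
  have i: "integrable circ (\<lambda>s. arcosh (max 1 (1 / (2 * sqrt (2 * (1 + cos s))) * x
      + 2 * (1 + cos s) / (2 * sqrt (2 * (1 + cos s))))))" if "x \<ge> 0" for x
    using integrable_arcosh_P[of "- x"] by (simp only: P_integrand_neg[OF that])
  have b: "b \<ge> 0" using assms by simp
  note d = integral_arcosh_affine_diff[OF _ _ AE_circ_weight_pos assms(2) i[OF assms(1)] i[OF b]]
  show "ennreal (P_integral (- b) - P_integral (- a)) = (\<integral>\<^sup>+ x\<in>{a<..<b}. P_period 2 x \<partial>lborel)"
    unfolding e[OF assms(1)] e[OF b] P_period_def by (rule d(1)) measurable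
  show "P_integral (- a) \<le> P_integral (- b)"
    unfolding e[OF assms(1)] e[OF b] by (rule d(2)) measurable
qed

lemma P_period_eq:
  "P_period e x = 2 * (\<integral>\<^sup>+ p\<in>{0<..<2}. ennreal (arcosh_kernel (1 / (2 * sqrt (2 * p)))
     (e * p / (2 * sqrt (2 * p))) x / sqrt (p * (2 - p))) \<partial>lborel)"
  unfolding P_period_def
  by (rule nn_integral_circ_cos[where f = "\<lambda>p. arcosh_kernel (1 / (2 * sqrt (2 * p))) (e * p / (2 * sqrt (2 * p))) x"])
     (auto intro: arcosh_kernel_nonneg)

lemma S_period_pos_eq:
  assumes "0 < x" "x < 4"
  shows "S_period_pos x = 2 * P_period (- 2) x"
proof -
  have "(\<integral>\<^sup>+ s. ennreal (arcosh_kernel (1 + cos s) (2 * ((1 + cos s) - 1)\<^sup>2 - 1) x) \<partial>circ)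
      = 2 * (\<integral>\<^sup>+ q\<in>{0<..<2}. ennreal (arcosh_kernel q (2 * (q - 1)\<^sup>2 - 1) x / sqrt (q * (2 - q))) \<partial>lborel)"
    by (rule nn_integral_circ_cos[where f = "\<lambda>q. arcosh_kernel q (2 * (q - 1)\<^sup>2 - 1) x"])
       (auto intro: arcosh_kernel_nonneg)
  then show ?thesis
    by (simp only: S_period_pos_def nn_integral_kernel_pos[OF assms] P_period_eq add_diff_cancel_left')
qed

lemma S_period_neg_eq:
  assumes "1 < x"
  shows "S_period_neg x = P_period 2 x"
proof -
  have "(\<integral>\<^sup>+ s. ennreal (arcosh_kernel (1 + cos s) (1 - 2 * ((1 + cos s) - 1)\<^sup>2) x) \<partial>circ)
      = 2 * (\<integral>\<^sup>+ q\<in>{0<..<2}. ennreal (arcosh_kernel q (1 - 2 * (q - 1)\<^sup>2) x / sqrt (q * (2 - q))) \<partial>lborel)"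
    by (rule nn_integral_circ_cos[where f = "\<lambda>q. arcosh_kernel q (1 - 2 * (q - 1)\<^sup>2) x"])
       (auto intro: arcosh_kernel_nonneg)
  then show ?thesis
    by (simp only: S_period_neg_def nn_integral_kernel_neg[OF assms] P_period_eq add_diff_cancel_left')
qed

lemma measurable_P_period [measurable]: "P_period e \<in> borel_measurable borel"
proof -
  have [measurable]: "cos \<in> borel_measurable circ"
    by (intro measurable_restrict_space1) measurable
  have "sigma_finite_measure circ" by unfold_locales
  then have "(\<lambda>x. P_period e x) \<in> borel_measurable borel"
    unfolding P_period_def by (rule sigma_finite_measure.borel_measurable_nn_integral)
      measurable
  then show ?thesis by simp
qed

lemma S_integral_0: "S_integral 0 = 0"
proof -
  have "\<bar>2 * (cos s)\<^sup>2 - 1 + 0 * (1 + cos s)\<bar> \<le> 1" for s :: real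
    using cos_sq_le_one[of s] zero_le_power2[of "cos s"] by (simp add: abs_le_iff)
  then show ?thesis
    unfolding S_integral_def by (simp only: arcosh_max_le_1) simp
qed

lemma P_integral_0: "P_integral 0 = 0"
proof -
  have "\<bar>(2 * (1 + cos s) - 0) / (2 * sqrt (2 * (1 + cos s)))\<bar> \<le> 1" for s :: real
  proof -
    define p where "p = 1 + cos s"
    have p: "p \<ge> 0" "p \<le> 2" unfolding p_def using one_plus_cos_nonneg cos_le_one[of s] by auto
    have *: "(2 * p - 0) / (2 * sqrt (2 * p)) = sqrt (2 * p) / 2"
      using real_div_sqrt[of "2 * p"] p by (simp add: field_simps)
    have "sqrt (2 * p) \<le> 2"
      using p real_sqrt_le_mono[of "2 * p" 4] by simp
    then show ?thesis
      unfolding p_def[symmetric] * using p by (subst abs_of_nonneg) auto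
  qed
  then show ?thesis
    unfolding P_integral_def by (simp only: arcosh_max_le_1) simp
qed

text \<open>Only parameters strictly between 0 and \<alpha> enter the integral. This admits \<alpha>
  = 4, although the identity of periods is used only below 4, and the vanishing of both means at 0
  fixes the constant.\<close>

lemma S_integral_pos:
  assumes "0 \<le> \<alpha>" "\<alpha> \<le> 4"
  shows "S_integral \<alpha> = 2 * P_integral \<alpha>"
proof -
  have "ennreal (S_integral \<alpha>) = (\<integral>\<^sup>+ x\<in>{0<..<\<alpha>}. S_period_pos x \<partial>lborel)"
    using S_integral_diff_pos[OF order_refl assms(1)] by (simp add: S_integral_0)
  also have "\<dots> = (\<integral>\<^sup>+ x. 2 * (P_period (- 2) x * indicator {0<..<\<alpha>} x) \<partial>lborel)"
    using assms(2) by (intro nn_integral_cong) (simp add: indicator_def S_period_pos_eq)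
  also have "\<dots> = 2 * (\<integral>\<^sup>+ x\<in>{0<..<\<alpha>}. P_period (- 2) x \<partial>lborel)"
    by (rule nn_integral_cmult) measurable
  also have "\<dots> = 2 * ennreal (P_integral \<alpha>)"
    using P_integral_diff_pos(1)[OF order_refl assms(1)] by (simp add: P_integral_0)
  also have "\<dots> = ennreal (2 * P_integral \<alpha>)"
    by (simp add: ennreal_mult')
  finally have "ennreal (S_integral \<alpha>) = ennreal (2 * P_integral \<alpha>)" .
  moreover have "S_integral \<alpha> \<ge> 0" "P_integral \<alpha> \<ge> 0"
    unfolding S_integral_def P_integral_def by (simp_all add: arcosh_max_nonneg)
  ultimately show ?thesis by simp
qed

lemma S_P_integral_diff_const:
  assumes "1 \<le> a" "a \<le> b"
  shows "S_integral (- b) - P_integral (- b) = S_integral (- a) - P_integral (- a)"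
proof -
  have a: "0 \<le> a" using assms by simp
  have "ennreal (S_integral (- b) - S_integral (- a)) = (\<integral>\<^sup>+ x\<in>{a<..<b}. S_period_neg x \<partial>lborel)"
    by (rule S_integral_diff_neg(1)[OF a assms(2)])
  also have "\<dots> = (\<integral>\<^sup>+ x\<in>{a<..<b}. P_period 2 x \<partial>lborel)"
    using assms(1) by (intro nn_integral_cong) (simp add: indicator_def S_period_neg_eq)
  also have "\<dots> = ennreal (P_integral (- b) - P_integral (- a))"
    by (rule P_integral_diff_neg(1)[OF a assms(2), symmetric])
  \<comment> \<open>Both differences are nonnegative by monotonicity, so equality of their
    \<open>ennreal\<close> images is equality of real numbers.\<close>
  finally show ?thesis
    using S_integral_diff_neg(2)[OF a assms(2)] P_integral_diff_neg(2)[OF a assms(2)] by simp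
qed

section \<open>Asymptotics as the parameter tends to minus infinity\<close>

lemma P_integral_bounds:
  assumes "n \<ge> 1"
  shows "2 * pi * ln n \<le> P_integral (- n)" "P_integral (- n) \<le> 2 * pi * ln (n + 4)"
proof -
  \<comment> \<open>The added term has mean 0 and cancels the singular denominator
    \<open>sqrt (2 * (1 + cos s))\<close> inside the logarithm. What remains is
    \<open>ln ((2 * p + n + sqrt d) / 2)\<close>, which is squeezed between \<open>ln n\<close> and
    \<open>ln (n + 4)\<close> uniformly in \<open>s\<close>.\<close>
  let ?X = "\<lambda>s. arcosh_max ((2 * (1 + cos s) - (- n)) / (2 * sqrt (2 * (1 + cos s)))) + ln (2 * (1 + cos s)) / 2"
  have int: "integrable circ ?X"
    by (intro Bochner_Integration.integrable_add integrable_arcosh_P integrable_divide ln_one_plus_cos)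
  have eq: "P_integral (- n) = integral\<^sup>L circ ?X"
    unfolding P_integral_def
    by (subst Bochner_Integration.integral_add[OF integrable_arcosh_P integrable_divide[OF ln_one_plus_cos(1)]])
       (simp only: integral_divide_zero ln_one_plus_cos(2) div_0 add_0_right)
  have bounds: "AE s in circ. ln n \<le> ?X s \<and> ?X s \<le> ln (n + 4)"
    using AE_circ_cos_neq
  proof eventually_elim
    case (elim s)
    define p where "p = 1 + cos s"
    have p: "0 < p" "p \<le> 2" using elim cos_le_one[of s] unfolding p_def by linarith+
    define d where "d = (2 * p + n)\<^sup>2 - 8 * p"
    define c where "c = 2 * sqrt (2 * p)"
    have c: "c > 0" "c\<^sup>2 = 8 * p" using p by (simp_all add: c_def)
    \<comment> \<open>The difference of the two sides is \<open>8 * p * (n - 1)\<close>, nonnegative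
      for \<open>n \<ge> 1\<close>. It gives both the reality of the square root and the lower bound
      \<open>n\<close>.\<close>
    have d_ge: "(n - 2 * p)\<^sup>2 \<le> d"
    proof -
      have "d = (n - 2 * p)\<^sup>2 + 8 * p * (n - 1)"
        unfolding d_def by (simp add: power2_eq_square algebra_simps)
      then show ?thesis using p assms by simp
    qed
    then have d0: "d \<ge> 0" using zero_le_power2 order_trans by blast
    have "(2 * p + n) / c \<ge> 1"
    proof -
      have "c\<^sup>2 \<le> (2 * p + n)\<^sup>2" using d0 c unfolding d_def by simp
      then have "c \<le> 2 * p + n" using p assms by (intro power2_le_imp_le[of c]) auto
      then show ?thesis using c by simp
    qed
    then have "arcosh_max ((2 * p + n) / c) = arcosh ((2 * p + n) / c)"
      using \<open>(2 * p + n) / c \<ge> 1\<close> by (subst arcosh_max_eq) (auto simp: max_absorb2)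
    also have "\<dots> = ln ((2 * p + n) / c + sqrt (((2 * p + n) / c)\<^sup>2 - 1))"
      using \<open>(2 * p + n) / c \<ge> 1\<close> by (rule arcosh_real_def)
    also have "((2 * p + n) / c)\<^sup>2 - 1 = d / c\<^sup>2"
      using c p by (simp add: d_def power_divide diff_divide_distrib)
    also have "(2 * p + n) / c + sqrt (d / c\<^sup>2) = (2 * p + n + sqrt d) / c"
      using c(1) by (simp add: real_sqrt_divide add_divide_distrib)
    also have "ln \<dots> = ln (2 * p + n + sqrt d) - ln c"
      using c p assms d0 by (intro ln_divide_pos add_pos_nonneg) auto
    also have "ln c = ln 2 + ln (2 * p) / 2"
      using p by (simp add: c_def ln_mult ln_sqrt)
    finally have X: "arcosh_max ((2 * p + n) / c) + ln (2 * p) / 2 = ln (2 * p + n + sqrt d) - ln 2"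
      by simp
    also have "\<dots> = ln ((2 * p + n + sqrt d) / 2)"
      using p assms d0 by (intro ln_divide_pos[symmetric] add_pos_nonneg) auto
    finally have X: "?X s = ln ((2 * p + n + sqrt d) / 2)"
      unfolding p_def[symmetric] c_def by simp
    have "\<bar>n - 2 * p\<bar> \<le> sqrt d"
      using real_sqrt_le_mono[OF d_ge] by simp
    then have "n - 2 * p \<le> sqrt d" by (rule abs_le_D1)
    then have 1: "n \<le> (2 * p + n + sqrt d) / 2" by (simp add: field_simps)
    have "sqrt d \<le> 2 * p + n"
      using p assms by (intro real_le_lsqrt) (auto simp: d_def)
    then have "(2 * p + n + sqrt d) / 2 \<le> n + 4" using p by (simp add: field_simps)
    then show ?case
      unfolding X using 1 assms by (intro conjI ln_mono) auto
  qed
  have "integral\<^sup>L circ (\<lambda>s. ln n) \<le> integral\<^sup>L circ ?X"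
    by (rule integral_mono_AE[OF _ int]) (use bounds in auto)
  then show "2 * pi * ln n \<le> P_integral (- n)"
    unfolding eq using measure_circ by simp
  have "integral\<^sup>L circ ?X \<le> integral\<^sup>L circ (\<lambda>s. ln (n + 4))"
    by (rule integral_mono_AE[OF int]) (use bounds in auto)
  then show "P_integral (- n) \<le> 2 * pi * ln (n + 4)"
    unfolding eq using measure_circ by simp
qed

text \<open>For fixed \<open>s\<close> with \<open>1 + cos s > 0\<close> the argument grows like
  \<open>(1 + cos s) * N\<close> and \<open>arcosh h - ln (2 * h)\<close> tends to 0, so subtracting
  \<open>ln N\<close> leaves \<open>ln (2 * (1 + cos s))\<close>, whose mean is 0. Near s = \<pi>
  this is not uniform, hence the dominated convergence.\<close>

lemma S_integral_limit: "(\<lambda>n. S_integral (- real (Suc n)) - 2 * pi * ln (real (Suc n))) \<longlonglongrightarrow> 0"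
proof -
  let ?N = "\<lambda>n. real (Suc n)"
  let ?h = "\<lambda>n s. (1 + cos s) * ?N n + (1 - 2 * (cos s)\<^sup>2)"
  let ?X = "\<lambda>n s. arcosh (max 1 (?h n s))"
  have X: "arcosh_max (2 * (cos s)\<^sup>2 - 1 + (- ?N n) * (1 + cos s)) = ?X n s" for n s
    by (rule S_integrand_neg) simp
  have int: "integrable circ (?X n)" for n
    using integrable_arcosh_S[of "- ?N n"] unfolding X .
  have "S_integral (- ?N n) - 2 * pi * ln (?N n) = (\<integral>s. ?X n s - ln (?N n) \<partial>circ)" for n
    using int[of n] measure_circ unfolding S_integral_def X
    by (subst Bochner_Integration.integral_diff) auto
  moreover have "(\<lambda>n. \<integral>s. ?X n s - ln (?N n) \<partial>circ) \<longlonglongrightarrow> (\<integral>s. ln (2 * (1 + cos s)) \<partial>circ)"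
  \<comment> \<open>The constant \<open>ln 6\<close> comes from the upper bound
    \<open>2 * max 1 h \<le> 6 * N\<close>, and \<open>2 * ln 2\<close> from the lower bound
    \<open>ln (p * N / 2)\<close>, which is \<open>ln (2 * p) + ln N - 2 * ln 2\<close>.\<close>
  proof (rule integral_dominated_convergence[where w = "\<lambda>s. \<bar>ln (2 * (1 + cos s))\<bar> + 2 * ln 2 + ln 6"])
    show "integrable circ (\<lambda>s. \<bar>ln (2 * (1 + cos s))\<bar> + 2 * ln 2 + ln 6)"
      by (intro Bochner_Integration.integrable_add integrable_abs ln_one_plus_cos) auto
    show "AE s in circ. (\<lambda>n. ?X n s - ln (?N n)) \<longlonglongrightarrow> ln (2 * (1 + cos s))"
      using AE_circ_cos_neq
    proof eventually_elim
      case (elim s)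
      define p where "p = 1 + cos s"
      define e where "e = 1 - 2 * (cos s)\<^sup>2"
      have p: "p > 0" using elim by (simp add: p_def)
      have "eventually (\<lambda>n. p * ?N n + e > 1) sequentially"
        using p by real_asymp
      then have "eventually (\<lambda>n. ln (p * ?N n + e + sqrt ((p * ?N n + e)\<^sup>2 - 1)) - ln (?N n) = ?X n s - ln (?N n)) sequentially"
        by eventually_elim (simp add: p_def e_def arcosh_real_def max_def)
      moreover have "(\<lambda>n. ln (p * ?N n + e + sqrt ((p * ?N n + e)\<^sup>2 - 1)) - ln (?N n)) \<longlonglongrightarrow> ln (2 * p)"
        using p by real_asymp
      ultimately show ?case
        unfolding p_def[symmetric] by (rule Lim_transform_eventually[rotated])
    qed
    show "AE s in circ. norm (?X n s - ln (?N n)) \<le> \<bar>ln (2 * (1 + cos s))\<bar> + 2 * ln 2 + ln 6" for n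
      using AE_circ_cos_neq
    proof eventually_elim
      case (elim s)
      define N where "N = ?N n"
      define p where "p = 1 + cos s"
      define h where "h = p * N + (1 - 2 * (cos s)\<^sup>2)"
      have N: "N \<ge> 1" by (simp add: N_def)
      have p: "0 < p" "p \<le> 2" using elim cos_le_one[of s] unfolding p_def by linarith+
      have h: "p * N - 1 \<le> h" "h \<le> p * N + 1"
        unfolding h_def using cos_sq_le_one[of s] zero_le_power2[of "cos s"] by linarith+
      have "p * N \<le> 2 * N" using p N by (intro mult_right_mono) auto
      then have "h \<le> 3 * N" using h N by linarith
      then have m: "max 1 h \<le> 3 * N" using N by simp
      define X where "X = arcosh (max 1 h)"
      have X_eq: "X = ln (max 1 h + sqrt ((max 1 h)\<^sup>2 - 1))"
        unfolding X_def by (rule arcosh_real_def) simp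
      have "X = arcosh_max (max 1 h)" by (simp add: X_def arcosh_max_def)
      also have "\<dots> \<le> ln (2 * max 1 h)"
        using arcosh_max_le_ln[of "max 1 h"] by simp
      also have "\<dots> \<le> ln (6 * N)"
        using m by (intro ln_mono) auto
      also have "\<dots> = ln 6 + ln N"
        using N by (simp add: ln_mult)
      finally have upper: "X - ln N \<le> ln 6" by simp
      \<comment> \<open>For \<open>p * N \<ge> 2\<close> one has
        \<open>h \<ge> p * N - 1 \<ge> p * N / 2\<close>; for smaller \<open>p * N\<close> the
        logarithm is at most 0, while \<open>X\<close> is nonnegative.\<close>
      have lower: "ln (p * N / 2) \<le> X"
      proof (cases "p * N \<ge> 2")
        case True
        have "p * N / 2 \<le> max 1 h" using h True by linarith
        also have "\<dots> \<le> max 1 h + sqrt ((max 1 h)\<^sup>2 - 1)" by (simp add: one_le_power)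
        finally show ?thesis
          unfolding X_eq using True by (intro ln_mono) auto
      next
        case False
        then have "ln (p * N / 2) \<le> 0" using p N by simp
        also have "0 \<le> X" by (simp add: X_def)
        finally show ?thesis .
      qed
      have "ln (p * N / 2) = ln (2 * p) + ln N - 2 * ln 2"
        using p N by (simp add: ln_mult ln_div)
      then have "X - ln N \<ge> ln (2 * p) - 2 * ln 2" using lower by linarith
      moreover have "ln (6 :: real) \<ge> 0" "ln (2 :: real) \<ge> 0" by simp_all
      ultimately have "\<bar>X - ln N\<bar> \<le> \<bar>ln (2 * p)\<bar> + 2 * ln 2 + ln 6"
        using upper by linarith
      then show ?case
        unfolding X_def h_def N_def p_def real_norm_def .
    qed
    show "(\<lambda>s. ?X n s - ln (?N n)) \<in> borel_measurable circ" for n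
      using int[of n] by (intro borel_measurable_diff borel_measurable_const borel_measurable_integrable)
    show "(\<lambda>s. ln (2 * (1 + cos s))) \<in> borel_measurable circ"
      using ln_one_plus_cos(1) by (rule borel_measurable_integrable)
  qed
  ultimately show ?thesis
    by (simp only: ln_one_plus_cos(2))
qed

lemma P_integral_limit: "(\<lambda>n. P_integral (- real (Suc n)) - 2 * pi * ln (real (Suc n))) \<longlonglongrightarrow> 0"
proof (rule tendsto_sandwich[OF always_eventually always_eventually])
  show "\<forall>n. 0 \<le> P_integral (- real (Suc n)) - 2 * pi * ln (real (Suc n))"
  proof
    fix n show "0 \<le> P_integral (- real (Suc n)) - 2 * pi * ln (real (Suc n))"
      using P_integral_bounds(1)[of "real (Suc n)"] by simp
  qed
  show "\<forall>n. P_integral (- real (Suc n)) - 2 * pi * ln (real (Suc n))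
      \<le> 2 * pi * ln (real (Suc n) + 4) - 2 * pi * ln (real (Suc n))"
  proof
    fix n show "P_integral (- real (Suc n)) - 2 * pi * ln (real (Suc n))
      \<le> 2 * pi * ln (real (Suc n) + 4) - 2 * pi * ln (real (Suc n))"
      using P_integral_bounds(2)[of "real (Suc n)"] by simp
  qed
  show "(\<lambda>n. 2 * pi * ln (real (Suc n) + 4) - 2 * pi * ln (real (Suc n))) \<longlonglongrightarrow> 0"
    by real_asymp
qed auto

lemma S_integral_neg:
  assumes "\<alpha> \<le> - 1"
  shows "S_integral \<alpha> = P_integral \<alpha>"
proof -
  let ?D = "\<lambda>x. S_integral (- x) - P_integral (- x)"
  have "?D (real (Suc n)) = ?D 1" for n
    by (rule S_P_integral_diff_const) auto
  moreover have "(\<lambda>n. ?D (real (Suc n))) \<longlonglongrightarrow> 0"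
    using tendsto_diff[OF S_integral_limit P_integral_limit] by simp
  ultimately have "?D 1 = 0"
    by (simp only: LIMSEQ_const_iff)
  moreover have "?D (- \<alpha>) = ?D 1"
    using assms by (intro S_P_integral_diff_const) auto
  ultimately show ?thesis by simp
qed

theorem theorem1:
  fixes \<alpha> :: real
  shows "(0 \<le> \<alpha> \<and> \<alpha> \<le> 4 \<longrightarrow> mahler_measure (S_poly \<alpha>) = 2 * mahler_measure (P_poly \<alpha>)) \<and>
         (\<alpha> \<le> -1 \<longrightarrow> mahler_measure (S_poly \<alpha>) = mahler_measure (P_poly \<alpha>))"
  unfolding mahler_S_poly mahler_P_poly
  unfolding S_integral_def[symmetric] P_integral_def[symmetric]
  using S_integral_pos[of \<alpha>] S_integral_neg[of \<alpha>] by simp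

end
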